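(* Let $(\Omega,\mathcal{F},(\mathcal{F}_t)_{t\ge 0},\mathbb{P})$ be a filtered probability space satisfying property (NP), let $(X_t)_{t\ge 0}$ be a submartingale of class $(\Sigma)$ on it with decomposition $X_t=N_t+A_t$, and let $\mathcal{Q}$ be the associated $\sigma$-finite measure. Suppose that $A_\infty=\infty$, $\mathbb{P}$-almost surely. Then, $\mathcal{Q}$-almost everywhere, $X_t$ tends to infinity as $t\to\infty$, and for every nonnegative, $\mathcal{Q}$-integrable functional $F$ on $(\Omega,\mathcal{F})$ one has, $\mathcal{Q}$-almost everywhere, $$\frac{M_t(F)}{X_t}\underset{t\to\infty}{\longrightarrow}F .$$
   Context: Notation: $\mathbb{P}[Y]$ denotes the expectation of $Y$ under $\mathbb{P}$ (and $\mathcal{Q}[Y]$ the integral of $Y$ under $\mathcal{Q}$); $F.\mathcal{Q}$ denotes the measure with density $F$ with respect to $\mathcal{Q}$; for an increasing process $(A_t)$, $A_\infty=\lim_{t\to\infty}A_t$. Class $(\Sigma)$: a nonnegative submartingale $(X_t)_{t\ge0}$ is of class $(\Sigma)$ iff $X_t=N_t+A_t$ where $(N_t)$ and $(A_t)$ are adapted, $(N_t)$ is a càdlàg martingale, $(A_t)$ is a continuous increasing process with $A_0=0$, and the measure $(dA_t)$ is carried by $\{t\ge0: X_t=0\}$. (In particular $X_t$ is integrable for all $t$.) Natural conditions: $(\Omega,\mathcal{F},(\mathcal{F}_t),\mathbb{P})$ satisfies the natural conditions iff $(\mathcal{F}_t)$ is right-continuous and, for all $t\ge0$ and every $\mathbb{P}$-negligible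 $A\in\mathcal{F}_t$, all subsets of $A$ belong to $\mathcal{F}_0$. The natural enlargement of a filtered probability space is its smallest extension (same $\Omega$, larger $\sigma$-algebras, extended probability) satisfying the natural conditions; it exists and is unique. Property (P): a filtered measurable space $(\Omega,\mathcal{F},(\mathcal{F}_t))$ with $\mathcal{F}=\bigvee_{t\ge0}\mathcal{F}_t$ satisfies (P) iff (i) each $\mathcal{F}_t$ is countably generated; (ii) for each $t$ there are a Polish space $\Omega_t$ and a surjection $\pi_t:\Omega\to\Omega_t$ such that $\mathcal{F}_t$ is the $\sigma$-algebra of inverse images under $\pi_t$ of Borel sets of $\Omega_t$, and for all $B\in\mathcal{F}_t$, $\omega\in\Omega$, $\pi_t(\omega)\in\pi_t(B)$ implies $\omega\in B$; (iii) if $(\omega_n)_{n\ge0}$ is a sequence in $\Omega$ with $\bigcap_{n=0}^N A_n(\omega_n)\ne\emptyset$ for all $N\ge0$, where $A_n(\omega_n)$ is the intersection of the sets of $\mathcal{F}_n$ containing $\omega_n$, then $\bigcap_{n=0}^\infty A_n(\omega_n)\neq\emptyset$. Property (NP): a filtered probability space satisfies (NP) iff it is the natural enlargement of a filtered probability space $(\Omega,\mathcal{F}^0,(\mathcal{F}^0_t),\mathbb{P}^0)$ such that $(\Omega,\mathcal{F}^0,(\mathcal{F}^0_t))$ satisfies (P). In this case $\mathcal{F}=\bigvee_{t\ge 0}\mathcal{F}_t$. The measure $\mathcal{Q}$ (known theorem): if $(X_t)$ is a submartingale of class $(\Sigma)$ on a space satisfying (NP) and $g:=\sup\{t\ge0: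 X_t=0\}$ (with $\sup\emptyset=0$), there is a unique $\sigma$-finite measure $\mathcal{Q}$ on $(\Omega,\mathcal{F})$ such that $\mathcal{Q}[g=\infty]=0$ and, for all $t\ge0$ and all bounded $\mathcal{F}_t$-measurable $F_t$, $\mathcal{Q}[F_t\mathds{1}_{g\le t}]=\mathbb{P}[F_tX_t]$. The martingale $M_t(F)$: for a nonnegative, $\mathcal{Q}$-integrable functional $F$ on $(\Omega,\mathcal{F})$, $(M_t(F))_{t\ge0}$ denotes the càdlàg $\mathbb{P}$-martingale, unique up to indistinguishability, such that $\mathcal{Q}[F\,\Gamma_t]=\mathbb{P}[\Gamma_tM_t(F)]$ for all $t\ge0$ and all bounded $\mathcal{F}_t$-measurable $\Gamma_t$. Processes that are $\mathbb{P}$-indistinguishable are also $\mathcal{Q}$-indistinguishable, so the behaviour of $M_t(F)$ under $\mathcal{Q}$ does not depend on the version. *)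

theory Defs
  imports "HOL-Probability.Probability"
begin

section \<open>Filtered spaces indexed by the nonnegative reals\<close>

text \<open>
  The underlying measurable space is carried by a measure \<open>M\<close>; a filtration is a family \<open>G\<close> of
  type \<open>real \<Rightarrow> 'a measure\<close> of which only the \<open>\<sigma>\<close>-algebras \<open>sets (G t)\<close> with \<open>t \<ge> 0\<close> matter. The
  locale predicate \<^const>\<open>filtration\<close> ranges over a whole index type, so negative times are
  collapsed to \<open>0\<close> by \<open>max 0\<close>.
\<close>

definition filtered_space :: "'a measure \<Rightarrow> (real \<Rightarrow> 'a measure) \<Rightarrow> bool" where
  "filtered_space M G \<longleftrightarrow>
     filtration (space M) (\<lambda>t. G (max 0 t)) \<and> (\<forall>t\<ge>0. subalgebra M (G t))"

definition filtered_prob_space :: "'a measure \<Rightarrow> (real \<Rightarrow> 'a measure) \<Rightarrow> bool" where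
  "filtered_prob_space P G \<longleftrightarrow> prob_space P \<and> filtered_space P G"

definition natural_conditions :: "'a measure \<Rightarrow> (real \<Rightarrow> 'a measure) \<Rightarrow> bool" where
  "natural_conditions P G \<longleftrightarrow>
     (\<forall>t\<ge>0. sets (G t) = (\<Inter>s\<in>{t<..}. sets (G s))) \<and>
     (\<forall>t\<ge>0. \<forall>A\<in>sets (G t). emeasure P A = 0 \<longrightarrow> (\<forall>B\<subseteq>A. B \<in> sets (G 0)))"

definition extends_filtered_prob_space ::
  "'a measure \<Rightarrow> (real \<Rightarrow> 'a measure) \<Rightarrow> 'a measure \<Rightarrow> (real \<Rightarrow> 'a measure) \<Rightarrow> bool" where
  "extends_filtered_prob_space P0 G0 P G \<longleftrightarrow>
     space P = space P0 \<and> sets P0 \<subseteq> sets P \<and>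
     (\<forall>t\<ge>0. sets (G0 t) \<subseteq> sets (G t)) \<and>
     (\<forall>A\<in>sets P0. emeasure P A = emeasure P0 A)"

definition natural_enlargement ::
  "'a measure \<Rightarrow> (real \<Rightarrow> 'a measure) \<Rightarrow> 'a measure \<Rightarrow> (real \<Rightarrow> 'a measure) \<Rightarrow> bool" where
  "natural_enlargement P0 G0 P G \<longleftrightarrow>
     filtered_prob_space P G \<and> natural_conditions P G \<and>
     extends_filtered_prob_space P0 G0 P G \<and>
     (\<forall>P' G'. filtered_prob_space P' G' \<and> natural_conditions P' G' \<and>
        extends_filtered_prob_space P0 G0 P' G' \<longrightarrow>
        extends_filtered_prob_space P G P' G')"

definition borel_sets_of :: "'a topology \<Rightarrow> 'a set set" where
  "borel_sets_of T = sigma_sets (topspace T) {U. openin T U}"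

definition filtration_atom :: "(real \<Rightarrow> 'a measure) \<Rightarrow> real \<Rightarrow> 'a \<Rightarrow> 'a set" where
  "filtration_atom G t \<omega> = \<Inter>{A \<in> sets (G t). \<omega> \<in> A}"

text \<open>
  In the second clause the Polish space \<open>\<Omega>\<^sub>t\<close> is a topology \<open>T\<close> on a subset of the type of
  \<open>\<Omega>\<close>. This is no restriction: \<open>\<Omega>\<^sub>t\<close> is the image of a surjection defined on \<open>\<Omega>\<close>, so its points
  can be replaced by representatives in \<open>\<Omega>\<close> and its topology transported.
\<close>

definition property_P :: "'a measure \<Rightarrow> (real \<Rightarrow> 'a measure) \<Rightarrow> bool" where
  "property_P M G \<longleftrightarrow>
     filtered_space M G \<and>
     sets M = sigma_sets (space M) (\<Union>t\<in>{0..}. sets (G t)) \<and>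
     (\<forall>t\<ge>0. \<exists>C. countable C \<and> C \<subseteq> Pow (space M) \<and> sets (G t) = sigma_sets (space M) C) \<and>
     (\<forall>t\<ge>0. \<exists>(T :: 'a topology) \<pi>.
        completely_metrizable_space T \<and> separable_space T \<and>
        \<pi> ` space M = topspace T \<and>
        sets (G t) = {\<pi> -` B \<inter> space M | B. B \<in> borel_sets_of T} \<and>
        (\<forall>B\<in>sets (G t). \<forall>\<omega>\<in>space M. \<pi> \<omega> \<in> \<pi> ` B \<longrightarrow> \<omega> \<in> B)) \<and>
     (\<forall>\<omega> :: nat \<Rightarrow> 'a. (\<forall>n. \<omega> n \<in> space M) \<longrightarrow>
        (\<forall>N. (\<Inter>n\<le>N. filtration_atom G (real n) (\<omega> n)) \<noteq> {}) \<longrightarrow>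
        (\<Inter>n. filtration_atom G (real n) (\<omega> n)) \<noteq> {})"

definition property_NP :: "'a measure \<Rightarrow> (real \<Rightarrow> 'a measure) \<Rightarrow> bool" where
  "property_NP P G \<longleftrightarrow>
     (\<exists>P0 G0. filtered_prob_space P0 G0 \<and> property_P P0 G0 \<and> natural_enlargement P0 G0 P G)"


section \<open>Submartingales of class \<open>(\<Sigma>)\<close>\<close>

definition adapted :: "(real \<Rightarrow> 'a measure) \<Rightarrow> (real \<Rightarrow> 'a \<Rightarrow> real) \<Rightarrow> bool" where
  "adapted G Y \<longleftrightarrow> (\<forall>t\<ge>0. Y t \<in> borel_measurable (G t))"

definition martingale ::
  "'a measure \<Rightarrow> (real \<Rightarrow> 'a measure) \<Rightarrow> (real \<Rightarrow> 'a \<Rightarrow> real) \<Rightarrow> bool" where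
  "martingale P G Y \<longleftrightarrow> adapted G Y \<and> (\<forall>t\<ge>0. integrable P (Y t)) \<and>
     (\<forall>s t. 0 \<le> s \<and> s \<le> t \<longrightarrow> (AE \<omega> in P. Y s \<omega> = real_cond_exp P (G s) (Y t) \<omega>))"

definition submartingale ::
  "'a measure \<Rightarrow> (real \<Rightarrow> 'a measure) \<Rightarrow> (real \<Rightarrow> 'a \<Rightarrow> real) \<Rightarrow> bool" where
  "submartingale P G Y \<longleftrightarrow> adapted G Y \<and> (\<forall>t\<ge>0. integrable P (Y t)) \<and>
     (\<forall>s t. 0 \<le> s \<and> s \<le> t \<longrightarrow> (AE \<omega> in P. Y s \<omega> \<le> real_cond_exp P (G s) (Y t) \<omega>))"

definition cadlag :: "(real \<Rightarrow> real) \<Rightarrow> bool" where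
  "cadlag f \<longleftrightarrow> (\<forall>t\<ge>0. (f \<longlongrightarrow> f t) (at_right t)) \<and> (\<forall>t>0. \<exists>l. (f \<longlongrightarrow> l) (at_left t))"

text \<open>
  Path properties are required for every \<open>\<omega>\<close>. The measure \<open>dA\<^sub>t(\<omega>)\<close> is the Stieltjes measure of
  \<open>A\<close> extended to negative times by its value \<open>A\<^sub>0 = 0\<close>, which gives \<open>(-\<infinity>, 0]\<close> no mass.
\<close>

definition class_Sigma ::
  "'a measure \<Rightarrow> (real \<Rightarrow> 'a measure) \<Rightarrow> (real \<Rightarrow> 'a \<Rightarrow> real) \<Rightarrow>
   (real \<Rightarrow> 'a \<Rightarrow> real) \<Rightarrow> (real \<Rightarrow> 'a \<Rightarrow> real) \<Rightarrow> bool" where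
  "class_Sigma P G X N A \<longleftrightarrow>
     submartingale P G X \<and> (\<forall>t\<ge>0. \<forall>\<omega>\<in>space P. 0 \<le> X t \<omega>) \<and>
     (\<forall>t\<ge>0. \<forall>\<omega>\<in>space P. X t \<omega> = N t \<omega> + A t \<omega>) \<and>
     martingale P G N \<and> (\<forall>\<omega>\<in>space P. cadlag (\<lambda>t. N t \<omega>)) \<and>
     adapted G A \<and>
     (\<forall>\<omega>\<in>space P. continuous_on {0..} (\<lambda>t. A t \<omega>) \<and> mono_on {0..} (\<lambda>t. A t \<omega>) \<and> A 0 \<omega> = 0) \<and>
     (\<forall>\<omega>\<in>space P. AE t in interval_measure (\<lambda>t. A (max 0 t) \<omega>). 0 \<le> t \<and> X t \<omega> = 0)"


section \<open>The measure \<open>\<Q>\<close> and the martingales \<open>M(F)\<close>\<close>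

text \<open>In \<^typ>\<open>ennreal\<close> the supremum of the empty set is \<open>0\<close>.\<close>

definition last_zero :: "(real \<Rightarrow> 'a \<Rightarrow> real) \<Rightarrow> 'a \<Rightarrow> ennreal" where
  "last_zero X \<omega> = (SUP t\<in>{t. 0 \<le> t \<and> X t \<omega> = 0}. ennreal t)"

definition bounded_rv :: "'a measure \<Rightarrow> ('a \<Rightarrow> real) \<Rightarrow> bool" where
  "bounded_rv H Y \<longleftrightarrow> Y \<in> borel_measurable H \<and> bounded (Y ` space H)"

text \<open>
  \<^const>\<open>has_bochner_integral\<close> states that the left-hand integral exists (so \<open>{g \<le> t}\<close> is measurable)
  and has the given value; a plain equation of \<^const>\<open>lebesgue_integral\<close>s could also hold through
  the default value \<open>0\<close> for functions that are not integrable.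
\<close>

definition associated_measure ::
  "'a measure \<Rightarrow> (real \<Rightarrow> 'a measure) \<Rightarrow> (real \<Rightarrow> 'a \<Rightarrow> real) \<Rightarrow> 'a measure \<Rightarrow> bool" where
  "associated_measure P G X Q \<longleftrightarrow>
     sets Q = sets P \<and> sigma_finite_measure Q \<and>
     (AE \<omega> in Q. last_zero X \<omega> \<noteq> \<infinity>) \<and>
     (\<forall>t\<ge>0. \<forall>\<Phi>. bounded_rv (G t) \<Phi> \<longrightarrow>
        has_bochner_integral Q (\<lambda>\<omega>. \<Phi> \<omega> * indicator {\<omega>. last_zero X \<omega> \<le> ennreal t} \<omega>)
          (\<integral>\<omega>. \<Phi> \<omega> * X t \<omega> \<partial>P))"

text \<open>\<open>M\<close> is a version of \<open>(M\<^sub>t(F))\<close>.\<close>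

definition associated_martingale ::
  "'a measure \<Rightarrow> (real \<Rightarrow> 'a measure) \<Rightarrow> 'a measure \<Rightarrow> ('a \<Rightarrow> real) \<Rightarrow>
   (real \<Rightarrow> 'a \<Rightarrow> real) \<Rightarrow> bool" where
  "associated_martingale P G Q F M \<longleftrightarrow>
     martingale P G M \<and> (\<forall>\<omega>\<in>space P. cadlag (\<lambda>t. M t \<omega>)) \<and>
     (\<forall>t\<ge>0. \<forall>\<Gamma>. bounded_rv (G t) \<Gamma> \<longrightarrow>
        (\<integral>\<omega>. F \<omega> * \<Gamma> \<omega> \<partial>Q) = (\<integral>\<omega>. \<Gamma> \<omega> * M t \<omega> \<partial>P))"

end

theory Submission
  imports Defs
begin

text \<open>
  Write \<open>\<nu>\<^sub>s\<close> for the restriction of \<open>\<Q>\<close> to \<open>{g \<le> s}\<close>, a finite measure. Everything rests on a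
  maximal inequality: if \<open>\<mu>\<^sub>1 \<le> K \<mu>\<^sub>2\<close> on the events of \<open>G t\<close> contained in \<open>S t\<close>, for all large \<open>t\<close>,
  then \<open>\<mu>\<^sub>1(B \<inter> limsup S) \<le> K \<mu>\<^sub>2(B)\<close> for every event \<open>B\<close>. It is applied to
  \<^item> \<open>\<nu>\<^sub>s\<close> and \<open>P\<close> with \<open>S t = {X t < K}\<close>; as \<open>A\<close> is unbounded and \<open>dA\<close> charges only zeros of \<open>X\<close>, the
    event \<open>B = {g \<le> s}\<close> is \<open>P\<close>-null, so \<open>X\<close> tends to infinity;
  \<^item> \<open>\<nu>\<^sub>s\<close> and \<open>F.\<Q>\<close> with \<open>S t = {M t > h X t}\<close>, which bounds the upper limit of \<open>M / X\<close>;
  \<^item> \<open>F.\<Q>\<close> and \<open>\<nu>\<^sub>s\<close> with \<open>S t = {M t < h X t}\<close> minus the event that \<open>X\<close> comes arbitrarily close to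
    zero in \<open>(s, t]\<close>, which is \<open>\<nu>\<^sub>s\<close>-null and off which \<open>g \<le> t\<close> implies \<open>g \<le> s\<close>; this bounds the lower limit.
  Limits are taken along rational times, which suffices by right-continuity.
\<close>

section \<open>Finite measures on a filtered space\<close>

lemma filtered_space_facts:
  assumes "filtered_space M G"
  shows filtered_space_space: "0 \<le> t \<Longrightarrow> space (G t) = space M"
    and filtered_space_sets: "0 \<le> t \<Longrightarrow> sets (G t) \<subseteq> sets M"
    and filtered_space_mono: "0 \<le> s \<Longrightarrow> s \<le> t \<Longrightarrow> sets (G s) \<subseteq> sets (G t)"
proof -
  show "0 \<le> t \<Longrightarrow> space (G t) = space M" "0 \<le> t \<Longrightarrow> sets (G t) \<subseteq> sets M"
    using assms by (auto simp: filtered_space_def subalgebra_def)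
  assume "0 \<le> s" "s \<le> t"
  with assms show "sets (G s) \<subseteq> sets (G t)"
    using filtration.sets_F_mono[of "space M" "\<lambda>t. G (max 0 t)" s t]
    by (simp add: filtered_space_def max_def)
qed

text \<open>Events that can be approximated in this way form a \<sigma>-algebra: complementation
  preserves symmetric differences, and a countable union is replaced by a finite one. One
  \<open>B\<close> must serve both measures, because an inequality between \<open>\<mu>\<close> and
  \<open>\<nu>\<close> is later carried from \<open>B\<close> to \<open>C\<close>.\<close>

lemma sigma_sets_approx:
  assumes fin: "finite_measure \<mu>" "finite_measure \<nu>" and eq: "sets \<nu> = sets \<mu>"
    and G: "filtered_space \<mu> G"
    and gen: "sets \<mu> = sigma_sets (space \<mu>) (\<Union>t\<in>{0..}. sets (G t))"
    and C: "C \<in> sets \<mu>" and "0 < \<epsilon>"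
  shows "\<exists>t\<ge>0. \<exists>B\<in>sets (G t). measure \<mu> (sym_diff B C) + measure \<nu> (sym_diff B C) < \<epsilon>"
proof -
  interpret \<mu>: finite_measure \<mu> by fact
  interpret \<nu>: finite_measure \<nu> by fact
  note [simp] = filtered_space_space[OF G]
  have sub: "B \<in> sets \<mu>" if "B \<in> sets (G t)" "0 \<le> t" for B t
    using filtered_space_sets[OF G] that by blast
  have "C \<in> sigma_sets (space \<mu>) (\<Union>t\<in>{0..}. sets (G t))"
    using C gen by simp
  then show ?thesis
    using \<open>0 < \<epsilon>\<close>
  proof (induction arbitrary: \<epsilon>)
    case (Basic a)
    then obtain t where "0 \<le> t" "a \<in> sets (G t)" by auto
    with Basic show ?case by (intro exI[of _ t] conjI bexI[of _ a]) auto
  next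
    case Empty
    then show ?case by (intro exI[of _ 0] conjI bexI[of _ "{}"]) auto
  next
    case (Compl a)
    then obtain t B where tB: "0 \<le> t" "B \<in> sets (G t)"
      "measure \<mu> (sym_diff B a) + measure \<nu> (sym_diff B a) < \<epsilon>" by blast
    have a: "a \<in> sets \<mu>" using Compl.hyps gen by simp
    have "sym_diff (space \<mu> - B) (space \<mu> - a) = sym_diff B a"
      using sets.sets_into_space[OF a] sets.sets_into_space[OF sub[OF tB(2,1)]] by blast
    moreover have "space \<mu> - B \<in> sets (G t)"
      using sets.compl_sets[OF tB(2)] tB(1) by simp
    ultimately show ?case
      using tB by (intro exI[of _ t] conjI bexI[of _ "space \<mu> - B"]) auto
  next
    case (Union a)
    have a: "a i \<in> sets \<mu>" for i using Union.hyps gen by simp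
    \<comment> \<open>The part of the union missed by the first \<open>n\<close> sets; it decreases
      to the empty set and so becomes small under both measures.\<close>
    define D where "D n = (\<Union>i. a i) - (\<Union>i<n. a i)" for n :: nat
    have D: "D n \<in> sets \<mu>" for n unfolding D_def using a by auto
    have dec: "decseq D" unfolding D_def decseq_def by fastforce
    have emp: "(\<Inter>n. D n) = {}" unfolding D_def by blast
    have "(\<lambda>n. measure \<mu> (D n)) \<longlonglongrightarrow> measure \<mu> (\<Inter>n. D n)"
      using D dec by (intro \<mu>.finite_Lim_measure_decseq) auto
    moreover have "(\<lambda>n. measure \<nu> (D n)) \<longlonglongrightarrow> measure \<nu> (\<Inter>n. D n)"
      using D dec eq by (intro \<nu>.finite_Lim_measure_decseq) auto
    ultimately have "(\<lambda>n. measure \<mu> (D n) + measure \<nu> (D n)) \<longlonglongrightarrow> 0"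
      using tendsto_add emp by fastforce
    then have "\<forall>\<^sub>F n in sequentially. measure \<mu> (D n) + measure \<nu> (D n) < \<epsilon> / 2"
      using Union.prems by (intro order_tendstoD(2)) auto
    then obtain n where n: "measure \<mu> (D n) + measure \<nu> (D n) < \<epsilon> / 2"
      by (auto simp: eventually_sequentially)
    \<comment> \<open>The \<open>n\<close> approximation errors then add up to at most
      \<open>\<epsilon> / 2\<close>; the \<open>+ 1\<close> covers \<open>n = 0\<close>.\<close>
    define \<delta> where "\<delta> = \<epsilon> / (2 * (real n + 1))"
    have "0 < \<delta>" unfolding \<delta>_def using Union.prems by simp
    then have "\<forall>i. \<exists>t B. 0 \<le> t \<and> B \<in> sets (G t) \<and>
        measure \<mu> (sym_diff B (a i)) + measure \<nu> (sym_diff B (a i)) < \<delta>"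
      using Union.IH by blast
    then obtain t B where tB: "\<And>i. 0 \<le> t i" "\<And>i. B i \<in> sets (G (t i))"
      "\<And>i. measure \<mu> (sym_diff (B i) (a i)) + measure \<nu> (sym_diff (B i) (a i)) < \<delta>"
      by metis
    \<comment> \<open>A sum of nonnegative times bounds each of them and, unlike a maximum, is also
      meaningful for \<open>n = 0\<close>.\<close>
    define T where "T = (\<Sum>i<n. t i)"
    have "0 \<le> T" unfolding T_def using tB by (intro sum_nonneg) auto
    have "t i \<le> T" if "i < n" for i
      unfolding T_def using that tB by (intro member_le_sum) auto
    then have B': "(\<Union>i<n. B i) \<in> sets (G T)"
      using tB filtered_space_mono[OF G] by (intro sets.finite_UN) blast+
    define E where "E i = sym_diff (B i) (a i)" for i
    have E: "E i \<in> sets \<mu>" for i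
      unfolding E_def using a sub tB by (metis sets.Diff sets.Un)
    have sd: "sym_diff (\<Union>i<n. B i) (\<Union>i. a i) \<subseteq> (\<Union>i<n. E i) \<union> D n"
      unfolding D_def E_def by blast
    have EU: "(\<Union>i<n. E i) \<in> sets \<mu>" using E by auto
    have "measure \<mu> (sym_diff (\<Union>i<n. B i) (\<Union>i. a i)) \<le> measure \<mu> ((\<Union>i<n. E i) \<union> D n)"
      using sd E D by (intro \<mu>.finite_measure_mono) auto
    also have "\<dots> \<le> measure \<mu> (\<Union>i<n. E i) + measure \<mu> (D n)"
      using EU D by (intro measure_Un_le) auto
    also have "measure \<mu> (\<Union>i<n. E i) \<le> (\<Sum>i<n. measure \<mu> (E i))"
      using E by (intro \<mu>.finite_measure_subadditive_finite) auto
    finally have 1: "measure \<mu> (sym_diff (\<Union>i<n. B i) (\<Union>i. a i))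
        \<le> (\<Sum>i<n. measure \<mu> (E i)) + measure \<mu> (D n)" by simp
    have "measure \<nu> (sym_diff (\<Union>i<n. B i) (\<Union>i. a i)) \<le> measure \<nu> ((\<Union>i<n. E i) \<union> D n)"
      using sd E D eq by (intro \<nu>.finite_measure_mono) auto
    also have "\<dots> \<le> measure \<nu> (\<Union>i<n. E i) + measure \<nu> (D n)"
      using EU D eq by (intro measure_Un_le) auto
    also have "measure \<nu> (\<Union>i<n. E i) \<le> (\<Sum>i<n. measure \<nu> (E i))"
      using E eq by (intro \<nu>.finite_measure_subadditive_finite) auto
    finally have 2: "measure \<nu> (sym_diff (\<Union>i<n. B i) (\<Union>i. a i))
        \<le> (\<Sum>i<n. measure \<nu> (E i)) + measure \<nu> (D n)" by simp
    have "(\<Sum>i<n. measure \<mu> (E i)) + (\<Sum>i<n. measure \<nu> (E i)) \<le> (\<Sum>i<n. \<delta>)"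
      unfolding sum.distrib[symmetric] E_def using tB(3) by (intro sum_mono less_imp_le)
    also have "\<dots> \<le> \<epsilon> / 2"
      unfolding \<delta>_def using Union.prems by (simp add: field_simps)
    finally show ?case
      using 1 2 n \<open>0 \<le> T\<close> B' by (intro exI[of _ T] conjI bexI[of _ "\<Union>i<n. B i"]) linarith+
  qed
qed

section \<open>First passage estimates\<close>

text \<open>The left-hand event is split according to the first time of \<open>R\<close> at which
  \<open>S\<close> is entered. The pieces \<open>D t\<close> are disjoint, and each is an event of
  \<open>G t\<close> inside both \<open>S t\<close> and \<open>B\<close>. So \<open>le\<close>
  applies to every piece, and the sum of the bounds is controlled by \<open>B\<close>.\<close>

lemma first_passage_finite:
  assumes fin: "finite_measure \<mu>" "finite_measure \<nu>" and eq: "sets \<nu> = sets \<mu>"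
    and G: "filtered_space \<mu> G" and "0 \<le> T" "0 \<le> K" and R: "finite R" "R \<subseteq> {T..}"
    and S: "\<And>t. t \<in> R \<Longrightarrow> S t \<in> sets (G t)"
    and le: "\<And>t C. t \<in> R \<Longrightarrow> C \<in> sets (G t) \<Longrightarrow> C \<subseteq> S t \<Longrightarrow> measure \<mu> C \<le> K * measure \<nu> C"
    and B: "B \<in> sets (G T)"
  shows "measure \<mu> (B \<inter> (\<Union>t\<in>R. S t)) \<le> K * measure \<nu> B"
proof -
  interpret \<mu>: finite_measure \<mu> by fact
  interpret \<nu>: finite_measure \<nu> by fact
  define D where "D t = B \<inter> S t - (\<Union>u\<in>{u\<in>R. u < t}. S u)" for t
  have DG: "D t \<in> sets (G t)" if "t \<in> R" for t
  proof -
    have "S u \<in> sets (G t)" if "u \<in> R" "u \<le> t" for u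
      using that S[of u] R order_trans[OF \<open>0 \<le> T\<close>, of u] filtered_space_mono[OF G, of u t] by blast
    moreover have "B \<in> sets (G t)"
      using that B R \<open>0 \<le> T\<close> filtered_space_mono[OF G, of T t] by auto
    ultimately show ?thesis
      unfolding D_def using that R by (intro sets.Diff sets.Int sets.finite_UN) auto
  qed
  have D: "D t \<in> sets \<mu>" if "t \<in> R" for t
  proof -
    have "0 \<le> t" using R that \<open>0 \<le> T\<close> by auto
    then show ?thesis using DG[OF that] filtered_space_sets[OF G] by blast
  qed
  have disj: "disjoint_family_on D R"
    unfolding disjoint_family_on_def
  proof (intro ballI impI)
    fix t u assume "t \<in> R" "u \<in> R" "t \<noteq> u"
    then show "D t \<inter> D u = {}"
      unfolding D_def by (cases "t < u") auto
  qed
  have un: "B \<inter> (\<Union>t\<in>R. S t) = (\<Union>t\<in>R. D t)"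
  proof safe
    fix \<omega> t assume \<omega>: "\<omega> \<in> B" "t \<in> R" "\<omega> \<in> S t"
    define m where "m = Min {t\<in>R. \<omega> \<in> S t}"
    have "m \<in> {t\<in>R. \<omega> \<in> S t}"
      unfolding m_def using R \<omega> by (intro Min_in) auto
    moreover have "\<not> u < m" if "u \<in> R" "\<omega> \<in> S u" for u
      unfolding m_def using R that by (simp add: not_less)
    ultimately have "m \<in> R" "\<omega> \<in> D m"
      unfolding D_def using \<omega>(1) by blast+
    then show "\<omega> \<in> (\<Union>t\<in>R. D t)" by blast
  qed (auto simp: D_def)
  have "measure \<mu> (B \<inter> (\<Union>t\<in>R. S t)) = (\<Sum>t\<in>R. measure \<mu> (D t))"
    unfolding un using R D disj by (intro \<mu>.finite_measure_finite_Union) auto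
  also have "\<dots> \<le> (\<Sum>t\<in>R. K * measure \<nu> (D t))"
    using le DG by (intro sum_mono) (auto simp: D_def)
  also have "\<dots> = K * measure \<nu> (\<Union>t\<in>R. D t)"
    using R D disj eq by (subst \<nu>.finite_measure_finite_Union) (auto simp: sum_distrib_left)
  also have "\<dots> \<le> K * measure \<nu> B"
    using filtered_space_sets[OF G, of T] B eq \<open>0 \<le> T\<close> \<open>0 \<le> K\<close>
    by (intro mult_left_mono \<nu>.finite_measure_mono) (auto simp: D_def)
  finally show ?thesis .
qed

text \<open>Continuity from below along finite subsets of \<open>R\<close>. The enumeration need not
  be increasing, since the finite estimate itself picks the first time in each finite set.\<close>

lemma first_passage:
  assumes fin: "finite_measure \<mu>" "finite_measure \<nu>" and eq: "sets \<nu> = sets \<mu>"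
    and G: "filtered_space \<mu> G" and "0 \<le> T" "0 \<le> K" and R: "countable R" "R \<subseteq> {T..}"
    and S: "\<And>t. t \<in> R \<Longrightarrow> S t \<in> sets (G t)"
    and le: "\<And>t C. t \<in> R \<Longrightarrow> C \<in> sets (G t) \<Longrightarrow> C \<subseteq> S t \<Longrightarrow> measure \<mu> C \<le> K * measure \<nu> C"
    and B: "B \<in> sets (G T)"
  shows "measure \<mu> (B \<inter> (\<Union>t\<in>R. S t)) \<le> K * measure \<nu> B"
\<comment> \<open>\<open>from_nat_into R\<close> has range \<open>R\<close> only when
  \<open>R\<close> is nonempty.\<close>
proof (cases "R = {}")
  case True
  then show ?thesis using \<open>0 \<le> K\<close> by simp
next
  case False
  interpret \<mu>: finite_measure \<mu> by fact
  define r where "r = from_nat_into R"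
  have r: "range r = R" unfolding r_def using False R by (simp add: range_from_nat_into)
  define U where "U n = B \<inter> (\<Union>t\<in>r ` {..n}. S t)" for n
  have "S t \<in> sets \<mu>" if "t \<in> R" for t
  proof -
    have "0 \<le> t" using R that \<open>0 \<le> T\<close> by auto
    then show ?thesis using S[OF that] filtered_space_sets[OF G] by blast
  qed
  moreover have "B \<in> sets \<mu>" using B filtered_space_sets[OF G] \<open>0 \<le> T\<close> by blast
  ultimately have "U n \<in> sets \<mu>" for n
    unfolding U_def using r by (intro sets.Int sets.finite_UN) auto
  moreover have "incseq U" unfolding U_def incseq_def
    by (intro allI impI Int_mono UN_mono image_mono) auto
  ultimately have "(\<lambda>n. measure \<mu> (U n)) \<longlonglongrightarrow> measure \<mu> (\<Union>n. U n)"
    by (intro \<mu>.finite_Lim_measure_incseq) auto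
  moreover have "(\<Union>n. U n) = B \<inter> (\<Union>t\<in>R. S t)"
    unfolding U_def r[symmetric] by auto
  moreover have "measure \<mu> (U n) \<le> K * measure \<nu> B" for n
    unfolding U_def
  proof (rule first_passage_finite[OF fin eq G \<open>0 \<le> T\<close> \<open>0 \<le> K\<close> _ _ _ _ B])
    have "r ` {..n} \<subseteq> R" using r by blast
    then show "r ` {..n} \<subseteq> {T..}"
      "\<And>t. t \<in> r ` {..n} \<Longrightarrow> S t \<in> sets (G t)"
      "\<And>t C. t \<in> r ` {..n} \<Longrightarrow> C \<in> sets (G t) \<Longrightarrow> C \<subseteq> S t \<Longrightarrow> measure \<mu> C \<le> K * measure \<nu> C"
      using R S le by blast+
  qed simp
  ultimately show ?thesis
    by (metis LIMSEQ_le_const2)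
qed

section \<open>Upper limits of events along rational times\<close>

text \<open>The upper limit of the events \<open>S t\<close> as \<open>t\<close> tends to infinity.
  Rational times keep the unions countable, hence measurable.\<close>

definition limsup_rat :: "(real \<Rightarrow> 'a set) \<Rightarrow> 'a set" where
  "limsup_rat S = (\<Inter>n::nat. \<Union>t\<in>\<rat> \<inter> {real n..}. S t)"

lemma not_in_limsup_rat:
  "\<omega> \<notin> limsup_rat S \<longleftrightarrow> (\<exists>n::nat. \<forall>t\<in>\<rat>. real n \<le> t \<longrightarrow> \<omega> \<notin> S t)"
  by (auto simp: limsup_rat_def)

lemma limsup_rat_sets:
  assumes "filtered_space \<mu> G" and "\<And>t. 0 \<le> t \<Longrightarrow> S t \<in> sets (G t)"
  shows "limsup_rat S \<in> sets \<mu>"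
proof -
  have "S t \<in> sets \<mu>" if "real n \<le> t" for t n
    using that assms filtered_space_sets[OF assms(1), of t] order_trans[of 0 "real n" t] by auto
  moreover have "countable (\<rat> \<inter> {real n..})" for n
    using countable_rat by blast
  ultimately have "(\<Union>t\<in>\<rat> \<inter> {real n..}. S t) \<in> sets \<mu>" for n :: nat
    by (intro sets.countable_UN') auto
  then show ?thesis unfolding limsup_rat_def by (intro sets.countable_INT) auto
qed

text \<open>On an event of \<open>G T\<close> this is the first passage estimate after time \<open>T\<close>; both sides are
  continuous in \<open>B\<close>, and such events are dense.\<close>

lemma measure_limsup_rat_le:
  assumes fin: "finite_measure \<mu>" "finite_measure \<nu>" and eq: "sets \<nu> = sets \<mu>"
    and G: "filtered_space \<mu> G"
    and gen: "sets \<mu> = sigma_sets (space \<mu>) (\<Union>t\<in>{0..}. sets (G t))"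
    and "0 \<le> K" "0 \<le> T"
    and S: "\<And>t. 0 \<le> t \<Longrightarrow> S t \<in> sets (G t)"
    and le: "\<And>t C. t \<in> \<rat> \<Longrightarrow> T \<le> t \<Longrightarrow> C \<in> sets (G t) \<Longrightarrow> C \<subseteq> S t \<Longrightarrow> measure \<mu> C \<le> K * measure \<nu> C"
    and B: "B \<in> sets \<mu>"
  shows "measure \<mu> (B \<inter> limsup_rat S) \<le> K * measure \<nu> B"
proof (rule field_le_epsilon)
  interpret \<mu>: finite_measure \<mu> by fact
  interpret \<nu>: finite_measure \<nu> by fact
  fix e :: real assume "0 < e"
  \<comment> \<open>Replacing \<open>B\<close> by \<open>B'\<close> costs at most
    \<open>\<epsilon>\<close> on the side of \<open>\<mu>\<close> and \<open>K * \<epsilon>\<close>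
    on the side of \<open>\<nu>\<close>, together \<open>e\<close>.\<close>
  define \<epsilon> where "\<epsilon> = e / (1 + K)"
  have "0 < \<epsilon>" unfolding \<epsilon>_def using \<open>0 < e\<close> \<open>0 \<le> K\<close> by simp
  obtain t B' where t: "0 \<le> t" "B' \<in> sets (G t)"
    "measure \<mu> (sym_diff B' B) + measure \<nu> (sym_diff B' B) < \<epsilon>"
    using sigma_sets_approx[OF fin eq G gen B \<open>0 < \<epsilon>\<close>] by blast
  \<comment> \<open>From \<open>T'\<close> on, \<open>B'\<close> is already decided and the
    domination \<open>le\<close> is available.\<close>
  define T' where "T' = max t T"
  have T': "0 \<le> T'" "T \<le> T'" "t \<le> T'" using t by (auto simp: T'_def)
  have B'G: "B' \<in> sets (G T')" using filtered_space_mono[OF G] t T' by blast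
  have B': "B' \<in> sets \<mu>" using B'G T' filtered_space_sets[OF G] by blast
  define U where "U = (\<Union>t\<in>\<rat> \<inter> {T'..}. S t)"
  have cR: "countable (\<rat> \<inter> {T'..})" using countable_rat by blast
  moreover have "S u \<in> sets \<mu>" if "T' \<le> u" for u
    using S[of u] filtered_space_sets[OF G, of u] order_trans[OF \<open>0 \<le> T'\<close> that] by blast
  ultimately have U: "U \<in> sets \<mu>" unfolding U_def by (intro sets.countable_UN') auto
  obtain n :: nat where "T' \<le> real n" using real_arch_simple by blast
  then have "\<rat> \<inter> {real n..} \<subseteq> \<rat> \<inter> {T'..}" by auto
  then have LU: "limsup_rat S \<subseteq> U" unfolding U_def limsup_rat_def by blast
  have m: "measure \<nu> B' \<le> measure \<nu> B + measure \<nu> (sym_diff B' B)"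
  proof -
    have "measure \<nu> B' \<le> measure \<nu> (B \<union> sym_diff B' B)"
      using B B' eq by (intro \<nu>.finite_measure_mono) auto
    also have "\<dots> \<le> measure \<nu> B + measure \<nu> (sym_diff B' B)"
      using B B' eq by (intro measure_Un_le) auto
    finally show ?thesis .
  qed
  have "measure \<mu> (B \<inter> limsup_rat S) \<le> measure \<mu> (B' \<inter> U \<union> sym_diff B' B)"
    using LU B B' U by (intro \<mu>.finite_measure_mono) auto
  also have "\<dots> \<le> measure \<mu> (B' \<inter> U) + measure \<mu> (sym_diff B' B)"
    using B B' U by (intro measure_Un_le) auto
  also have "measure \<mu> (B' \<inter> U) \<le> K * measure \<nu> B'"
    unfolding U_def
  proof (rule first_passage[OF fin eq G \<open>0 \<le> T'\<close> \<open>0 \<le> K\<close> cR _ _ _ B'G])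
    fix t assume "t \<in> \<rat> \<inter> {T'..}"
    then have t: "0 \<le> t" "T \<le> t" "t \<in> \<rat>" using T' by auto
    then show "S t \<in> sets (G t)" using S by blast
    show "measure \<mu> C \<le> K * measure \<nu> C" if "C \<in> sets (G t)" "C \<subseteq> S t" for C
      using le t that by blast
  qed simp
  also have "K * measure \<nu> B' \<le> K * (measure \<nu> B + measure \<nu> (sym_diff B' B))"
    using m \<open>0 \<le> K\<close> by (intro mult_left_mono)
  finally have "measure \<mu> (B \<inter> limsup_rat S)
      \<le> K * measure \<nu> B + (K * measure \<nu> (sym_diff B' B) + measure \<mu> (sym_diff B' B))"
    by (simp add: algebra_simps)
  also have "K * measure \<nu> (sym_diff B' B) \<le> K * \<epsilon>"
    using t \<open>0 \<le> K\<close> measure_nonneg[of \<mu> "sym_diff B' B"] by (intro mult_left_mono) linarith+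
  also have "measure \<mu> (sym_diff B' B) \<le> \<epsilon>"
    using t measure_nonneg[of \<nu> "sym_diff B' B"] by linarith
  also have "K * \<epsilon> + \<epsilon> = (1 + K) * \<epsilon>" by (simp add: distrib_right)
  also have "\<dots> = e" unfolding \<epsilon>_def using \<open>0 \<le> K\<close> by simp
  finally show "measure \<mu> (B \<inter> limsup_rat S) \<le> K * measure \<nu> B + e" by simp
qed

section \<open>Generation of the \<sigma>-algebra by the filtration under property (NP)\<close>

text \<open>Restricting \<open>P\<close> to the \<open>\<sigma>\<close>-algebra generated by the enlarged filtration gives a competitor
  in the minimality clause of the enlargement.\<close>

lemma property_NP_generated:
  assumes fp: "filtered_prob_space P G" and NP: "property_NP P G"
  shows "sets P = sigma_sets (space P) (\<Union>t\<in>{0..}. sets (G t))"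
proof -
  obtain P0 G0 where P0: "property_P P0 G0" and ne: "natural_enlargement P0 G0 P G"
    using NP unfolding property_NP_def by blast
  have fs: "filtered_space P G" and "prob_space P"
    using fp by (auto simp: filtered_prob_space_def)
  define \<A> where "\<A> = sigma_sets (space P) (\<Union>t\<in>{0..}. sets (G t))"
  define P' where "P' = restr_to_subalg P (sigma (space P) (\<Union>t\<in>{0..}. sets (G t)))"
  have UN: "(\<Union>t\<in>{0..}. sets (G t)) \<subseteq> sets P"
    using filtered_space_sets[OF fs] by auto
  then have UNP: "(\<Union>t\<in>{0..}. sets (G t)) \<subseteq> Pow (space P)"
    using sets.space_closed by blast
  have \<A>P: "\<A> \<subseteq> sets P" unfolding \<A>_def by (rule sets.sigma_sets_subset[OF UN])
  have sA: "sets (sigma (space P) (\<Union>t\<in>{0..}. sets (G t))) = \<A>"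
    unfolding \<A>_def using UNP by (rule sets_measure_of)
  have subP: "subalgebra P (sigma (space P) (\<Union>t\<in>{0..}. sets (G t)))"
    unfolding subalgebra_def sA using \<A>P UNP by (simp add: space_measure_of_conv)
  have setsP': "sets P' = \<A>" unfolding P'_def using sA subP by (simp add: sets_restr_to_subalg)
  have spP': "space P' = space P"
    unfolding P'_def by (simp add: space_restr_to_subalg space_measure_of_conv)
  have em: "emeasure P' S = emeasure P S" if "S \<in> \<A>" for S
    unfolding P'_def using that sA subP by (simp add: emeasure_restr_to_subalg)
  have GA: "sets (G t) \<subseteq> \<A>" if "0 \<le> t" for t
    unfolding \<A>_def using that by (intro subsetI sigma_sets.Basic) auto
  have "prob_space P'"
    unfolding P'_def using subP \<open>prob_space P\<close> by (rule prob_space_restr_to_subalg)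
  then have 1: "filtered_prob_space P' G"
    using fs GA unfolding filtered_prob_space_def filtered_space_def
    by (auto simp: spP' subalgebra_def setsP')
  have nc: "natural_conditions P G" and ex: "extends_filtered_prob_space P0 G0 P G"
    using ne unfolding natural_enlargement_def by blast+
  have 2: "natural_conditions P' G"
    using nc em GA unfolding natural_conditions_def by (metis subsetD)
  \<comment> \<open>Property (P) includes that the original space is generated by its filtration, so
    all events of \<open>P0\<close> survive the restriction to \<open>\<A>\<close>.\<close>
  have "sets P0 = sigma_sets (space P) (\<Union>t\<in>{0..}. sets (G0 t))"
    using P0 ex unfolding property_P_def extends_filtered_prob_space_def by simp
  also have "\<dots> \<subseteq> \<A>"
    unfolding \<A>_def using ex unfolding extends_filtered_prob_space_def
    by (intro sigma_sets_mono') (auto 4 4)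
  finally have "extends_filtered_prob_space P0 G0 P' G"
    using ex em unfolding extends_filtered_prob_space_def by (auto simp: spP' setsP')
  with 1 2 ne have "extends_filtered_prob_space P G P' G"
    unfolding natural_enlargement_def by blast
  then have "sets P \<subseteq> \<A>" by (simp add: extends_filtered_prob_space_def setsP')
  with \<A>P show ?thesis unfolding \<A>_def by blast
qed

section \<open>Ratios of martingales under \<open>\<Q>\<close>\<close>

text \<open>Turns inequalities known at rational times into inequalities at all times.\<close>

lemma right_continuous_nonneg:
  fixes f :: "real \<Rightarrow> real"
  assumes rc: "(f \<longlongrightarrow> f t) (at_right t)" and nn: "\<And>u. u \<in> \<rat> \<Longrightarrow> t < u \<Longrightarrow> 0 \<le> f u"
  shows "0 \<le> f t"
proof (rule ccontr)
  assume "\<not> 0 \<le> f t"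
  then have "\<forall>\<^sub>F u in at_right t. f u < 0" using rc by (intro order_tendstoD(2)) auto
  then obtain b where b: "t < b" "\<And>u. t < u \<Longrightarrow> u < b \<Longrightarrow> f u < 0"
    unfolding eventually_at_right_field by blast
  obtain u where "u \<in> \<rat>" "t < u" "u < b" using Rats_dense_in_real[OF b(1)] by blast
  with b(2)[of u] nn[of u] show False by simp
qed

lemma null_sets_of_integral_nonpos:
  fixes f :: "'a \<Rightarrow> real"
  assumes B: "B \<in> sets M" and i: "integrable M (\<lambda>x. indicator B x * f x)"
    and pos: "\<And>x. x \<in> B \<Longrightarrow> 0 < f x" and le: "(\<integral>x. indicator B x * f x \<partial>M) \<le> 0"
  shows "B \<in> null_sets M"
proof -
  have nn: "0 \<le> indicator B x * f x" for x
    using pos[of x] by (auto simp: indicator_def)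
  then have "(\<integral>x. indicator B x * f x \<partial>M) = 0"
    using le by (intro antisym integral_nonneg_AE) auto
  then have "AE x in M. indicator B x * f x = 0"
    using integral_nonneg_eq_0_iff_AE[OF i] nn by auto
  then have "AE x in M. x \<notin> B"
    by eventually_elim (use pos in \<open>fastforce simp: indicator_def\<close>)
  then show ?thesis using B by (simp add: AE_iff_null_sets)
qed

section \<open>The measure \<open>Q\<close> and its finite restrictions\<close>

text \<open>Property (NP) enters in the form \<open>gen\<close>, which makes the events of finite
  time dense.\<close>

locale class_Sigma_space =
  fixes P Q :: "'a measure" and G :: "real \<Rightarrow> 'a measure"
    and X N A :: "real \<Rightarrow> 'a \<Rightarrow> real"
  assumes fps: "filtered_prob_space P G"
    and gen: "sets P = sigma_sets (space P) (\<Union>t\<in>{0..}. sets (G t))"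
    and Sigma: "class_Sigma P G X N A"
    and ass: "associated_measure P G X Q"
begin

sublocale P: prob_space P
  using fps by (simp add: filtered_prob_space_def)

lemma filt: "filtered_space P G"
  using fps by (simp add: filtered_prob_space_def)

lemma G_sets: "0 \<le> t \<Longrightarrow> C \<in> sets (G t) \<Longrightarrow> C \<in> sets P"
  using filtered_space_sets[OF filt] by blast

lemma sets_Q [simp, measurable_cong]: "sets Q = sets P"
  using ass by (simp add: associated_measure_def)

lemma space_Q [simp]: "space Q = space P"
  by (rule sets_eq_imp_space_eq) simp

lemma X_adapted: "0 \<le> t \<Longrightarrow> X t \<in> borel_measurable (G t)"
  using Sigma by (simp add: class_Sigma_def submartingale_def adapted_def)

lemma X_integrable: "0 \<le> t \<Longrightarrow> integrable P (X t)"
  using Sigma by (simp add: class_Sigma_def submartingale_def)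

lemma X_right_continuous:
  assumes "0 \<le> t" "\<omega> \<in> space P"
  shows "((\<lambda>t. X t \<omega>) \<longlongrightarrow> X t \<omega>) (at_right t)"
proof -
  have XNA: "X u \<omega> = N u \<omega> + A u \<omega>" if "0 \<le> u" for u
    using Sigma assms that by (simp add: class_Sigma_def)
  have "((\<lambda>t. N t \<omega>) \<longlongrightarrow> N t \<omega>) (at_right t)"
    using Sigma assms by (simp add: class_Sigma_def cadlag_def)
  moreover have "continuous_on {0..} (\<lambda>t. A t \<omega>)"
    using Sigma assms by (simp add: class_Sigma_def)
  then have "((\<lambda>t. A t \<omega>) \<longlongrightarrow> A t \<omega>) (at t within {0..})"
    using assms by (simp add: continuous_on)
  then have "((\<lambda>t. A t \<omega>) \<longlongrightarrow> A t \<omega>) (at_right t)"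
    by (rule tendsto_within_subset) (use assms in auto)
  ultimately have "((\<lambda>t. N t \<omega> + A t \<omega>) \<longlongrightarrow> N t \<omega> + A t \<omega>) (at_right t)"
    by (rule tendsto_add)
  moreover have "\<forall>\<^sub>F u in at_right t. N u \<omega> + A u \<omega> = X u \<omega>"
    using XNA assms by (auto simp: eventually_at_right_field intro!: exI[of _ "t + 1"])
  ultimately show ?thesis
    unfolding XNA[OF assms(1)] by (rule Lim_transform_eventually)
qed

definition Z :: "real \<Rightarrow> 'a set" where
  "Z s = {\<omega>\<in>space P. last_zero X \<omega> \<le> ennreal s}"

lemma associated_measure_facts:
  assumes t: "0 \<le> t"
  shows Z_sets: "Z t \<in> sets P"
    and Z_finite: "emeasure Q (Z t) < \<infinity>"
    and measure_Z: "C \<in> sets (G t) \<Longrightarrow> measure Q (Z t \<inter> C) = (\<integral>\<omega>. indicator C \<omega> * X t \<omega> \<partial>P)"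
proof -
  \<comment> \<open>Indicators of events of \<open>G t\<close> are admissible test functions. The
    choice \<open>C = space P\<close> yields measurability and finite mass of
    \<open>Z t\<close>.\<close>
  have *: "has_bochner_integral Q (indicator (Z t \<inter> C)) (\<integral>\<omega>. indicator C \<omega> * X t \<omega> \<partial>P)"
    if C: "C \<in> sets (G t)" for C
  proof -
    have "bounded_rv (G t) (indicator C)"
      unfolding bounded_rv_def using C
      by (auto intro!: boundedI[of _ 1] simp: indicator_def)
    then have "has_bochner_integral Q
        (\<lambda>\<omega>. indicator C \<omega> * indicator {\<omega>. last_zero X \<omega> \<le> ennreal t} \<omega>)
        (\<integral>\<omega>. indicator C \<omega> * X t \<omega> \<partial>P)"
      using ass t by (simp add: associated_measure_def)
    then show ?thesis
      by (subst has_bochner_integral_cong[OF refl _ refl]) (auto simp: Z_def indicator_def)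
  qed
  have "space P \<in> sets (G t)"
    using sets.top[of "G t"] filtered_space_space[OF filt t] by simp
  then have i: "integrable Q (indicator (Z t) :: 'a \<Rightarrow> real)"
    using *[of "space P"] by (simp add: Z_def has_bochner_integral_iff Int_absorb2)
  then have "Z t \<inter> space Q \<in> sets Q" "emeasure Q (Z t \<inter> space Q) < \<infinity>"
    by (auto simp: integrable_indicator_iff)
  then show "Z t \<in> sets P" "emeasure Q (Z t) < \<infinity>" by (auto simp: Z_def Int_def conj_commute)
  assume C: "C \<in> sets (G t)"
  show "measure Q (Z t \<inter> C) = (\<integral>\<omega>. indicator C \<omega> * X t \<omega> \<partial>P)"
    using *[OF C] sets.sets_into_space[OF G_sets[OF t C]]
    by (simp add: has_bochner_integral_iff Int_assoc Int_absorb2)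
qed

lemma Z_mono: "s \<le> t \<Longrightarrow> Z s \<subseteq> Z t"
  unfolding Z_def by (auto intro: order_trans ennreal_leI)

text \<open>Encoded as a density, so that the \<sigma>-algebra remains that of \<open>P\<close>, as
  the estimates comparing two measures require.\<close>

definition \<nu> :: "real \<Rightarrow> 'a measure" where
  "\<nu> s = density Q (indicator (Z s))"

lemma sets_\<nu> [simp, measurable_cong]: "sets (\<nu> s) = sets P"
  by (simp add: \<nu>_def)

lemma measure_\<nu>: "0 \<le> s \<Longrightarrow> C \<in> sets P \<Longrightarrow> measure (\<nu> s) C = measure Q (Z s \<inter> C)"
  unfolding \<nu>_def using Z_sets by (intro measure_restricted) auto

lemma finite_\<nu>: "0 \<le> s \<Longrightarrow> finite_measure (\<nu> s)"
  using Z_sets[of s] Z_finite[of s]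
  by (intro finite_measureI) (simp add: \<nu>_def emeasure_restricted)

text \<open>Since \<open>Z s\<close> is contained in \<open>Z t\<close>, the defining identity of
  \<open>Q\<close> at time \<open>t\<close> gives the bound: on \<open>G t\<close>, the measure
  \<open>\<nu> s\<close> has density at most \<open>X t\<close> with respect to
  \<open>P\<close>.\<close>

lemma measure_\<nu>_le:
  assumes "0 \<le> s" "s \<le> t" "C \<in> sets (G t)"
  shows "measure (\<nu> s) C \<le> (\<integral>\<omega>. indicator C \<omega> * X t \<omega> \<partial>P)"
proof -
  have C: "C \<in> sets P" using G_sets[of t C] assms by simp
  have "measure (\<nu> s) C = measure Q (Z s \<inter> C)" using measure_\<nu> assms C by simp
  also have "\<dots> \<le> measure Q (Z t \<inter> C)"
  proof (rule measure_mono_fmeasurable)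
    have "Z t \<in> fmeasurable Q"
      using Z_sets[of t] Z_finite[of t] assms by (intro fmeasurableI) auto
    then show "Z t \<inter> C \<in> fmeasurable Q"
      by (rule fmeasurableI2) (use Z_sets[of t] C assms in auto)
  qed (use Z_mono[OF assms(2)] Z_sets[of s] C assms in auto)
  finally show ?thesis using measure_Z assms by simp
qed

lemma integrable_X_on:
  assumes "0 \<le> t" "C \<in> sets (G t)"
  shows "integrable P (\<lambda>\<omega>. indicator C \<omega> * X t \<omega>)"
  using integrable_mult_indicator[OF G_sets[OF assms] X_integrable[OF assms(1)]] by simp

lemma space_\<nu> [simp]: "space (\<nu> s) = space P"
  by (rule sets_eq_imp_space_eq) simp

lemma filtered_\<nu>: "filtered_space (\<nu> s) G"
  using filt by (simp add: filtered_space_def subalgebra_def)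

lemma measure_\<nu>_limsup_rat_le:
  assumes \<mu>: "finite_measure \<mu>" "sets \<mu> = sets P" and "0 \<le> s" "0 \<le> K"
    and S: "\<And>t. 0 \<le> t \<Longrightarrow> S t \<in> sets (G t)"
    and le: "\<And>t C. s \<le> t \<Longrightarrow> C \<in> sets (G t) \<Longrightarrow> C \<subseteq> S t \<Longrightarrow>
      (\<integral>\<omega>. indicator C \<omega> * X t \<omega> \<partial>P) \<le> K * measure \<mu> C"
    and B: "B \<in> sets P"
  shows "measure (\<nu> s) (B \<inter> limsup_rat S) \<le> K * measure \<mu> B"
proof (rule measure_limsup_rat_le[where T=s])
  show "filtered_space (\<nu> s) G" by (rule filtered_\<nu>)
  show "sets (\<nu> s) = sigma_sets (space (\<nu> s)) (\<Union>t\<in>{0..}. sets (G t))"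
    using gen by simp
  fix t C assume "s \<le> t" "C \<in> sets (G t)" "C \<subseteq> S t"
  then show "measure (\<nu> s) C \<le> K * measure \<mu> C"
    using measure_\<nu>_le[of s t C] le[of t C] assms by linarith
qed (use assms finite_\<nu> in auto)

lemma integral_X_le:
  assumes "0 \<le> t" "C \<in> sets (G t)" "C \<subseteq> {\<omega>\<in>space P. X t \<omega> < K}"
  shows "(\<integral>\<omega>. indicator C \<omega> * X t \<omega> \<partial>P) \<le> K * measure P C"
proof -
  have C: "C \<in> sets P" using G_sets[of t C] assms by simp
  have "(\<integral>\<omega>. indicator C \<omega> * X t \<omega> \<partial>P) \<le> (\<integral>\<omega>. indicator C \<omega> * K \<partial>P)"
  proof (rule integral_mono)
    show "integrable P (\<lambda>\<omega>. indicator C \<omega> * K)"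
      using integrable_mult_indicator[OF C, of "\<lambda>_. K"] by simp
  qed (use assms integrable_X_on in \<open>auto simp: indicator_def\<close>)
  also have "\<dots> = K * measure P C" using C by simp
  finally show ?thesis .
qed

lemma X_less_sets: "0 \<le> t \<Longrightarrow> {\<omega>\<in>space P. X t \<omega> < K} \<in> sets (G t)"
  using borel_measurable_less[OF X_adapted borel_measurable_const, of t K]
  by (simp add: filtered_space_space[OF filt])

lemma AE_\<nu>_imp:
  assumes "0 \<le> s" and B: "B \<in> sets P" and 0: "measure (\<nu> s) B = 0"
  shows "AE \<omega> in Q. \<omega> \<in> Z s \<longrightarrow> \<omega> \<notin> B"
proof (rule AE_I)
  interpret \<nu>: finite_measure "\<nu> s" using assms by (intro finite_\<nu>)
  show "{\<omega> \<in> space Q. \<not> (\<omega> \<in> Z s \<longrightarrow> \<omega> \<notin> B)} \<subseteq> Z s \<inter> B" by auto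
  show "Z s \<inter> B \<in> sets Q" using Z_sets assms by auto
  have "emeasure (\<nu> s) B = 0" using 0 by (simp add: \<nu>.emeasure_eq_measure)
  then show "emeasure Q (Z s \<inter> B) = 0"
    using assms Z_sets by (simp add: \<nu>_def emeasure_restricted)
qed

section \<open>Convergence of \<open>X\<close> to infinity\<close>

text \<open>On \<open>Z s\<close> there is no zero of \<open>X\<close> after \<open>s\<close>, so
  \<open>dA\<close> gives no mass to times after \<open>s\<close> and \<open>A\<close> stays
  constant there; this contradicts its divergence.\<close>

lemma Z_null:
  assumes A: "AE \<omega> in P. filterlim (\<lambda>t. A t \<omega>) at_top at_top" and s: "0 \<le> s"
  shows "measure P (Z s) = 0"
proof -
  have "AE \<omega> in P. \<omega> \<notin> Z s"
    using A AE_space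
  proof eventually_elim
    fix \<omega> assume lim: "filterlim (\<lambda>t. A t \<omega>) at_top at_top" and \<omega>: "\<omega> \<in> space P"
    show "\<omega> \<notin> Z s"
    proof
      assume "\<omega> \<in> Z s"
      then have g: "last_zero X \<omega> \<le> ennreal s" by (simp add: Z_def)
      have pos: "X u \<omega> \<noteq> 0" if "s < u" for u
      proof
        assume "X u \<omega> = 0"
        then have "ennreal u \<le> last_zero X \<omega>"
          unfolding last_zero_def using that s by (intro SUP_upper) auto
        then have "ennreal u \<le> ennreal s" using g by simp
        then show False using that s by (simp add: ennreal_le_iff)
      qed
      define I where "I = interval_measure (\<lambda>t. A (max 0 t) \<omega>)"
      have cont: "continuous_on {0..} (\<lambda>t. A t \<omega>)" and mono: "mono_on {0..} (\<lambda>t. A t \<omega>)"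
        and carried: "AE t in I. 0 \<le> t \<and> X t \<omega> = 0"
        using Sigma \<omega> unfolding class_Sigma_def I_def by auto
      have "\<forall>\<^sub>F t in at_top. A s \<omega> + 1 \<le> A t \<omega>"
        using lim by (simp add: filterlim_at_top)
      then obtain b where b: "s \<le> b" "A s \<omega> + 1 \<le> A b \<omega>"
        unfolding eventually_at_top_linorder by (metis linorder_linear max.cobounded1 max.cobounded2)
      \<comment> \<open>Freezing \<open>A\<close> at its value at \<open>0\<close> for negative
        times keeps it continuous and monotone on the whole line, as the formula for the Stieltjes
        measure of an interval demands.\<close>
      have "continuous_on UNIV (\<lambda>t. A (max 0 t) \<omega>)"
        by (rule continuous_on_compose2[OF cont]) (auto intro!: continuous_intros)
      then have "continuous (at_right a) (\<lambda>t. A (max 0 t) \<omega>)" for a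
        by (simp add: continuous_on_eq_continuous_at continuous_at_imp_continuous_within)
      moreover have "A (max 0 x) \<omega> \<le> A (max 0 y) \<omega>" if "x \<le> y" for x y
        using mono that by (intro mono_onD[OF mono]) auto
      ultimately have "emeasure I {s<..b} = ennreal (A (max 0 b) \<omega> - A (max 0 s) \<omega>)"
        unfolding I_def using b by (intro emeasure_interval_measure_Ioc) auto
      also have "\<dots> = ennreal (A b \<omega> - A s \<omega>)" using s b by (simp add: max_def)
      also have "\<dots> > 0" using b by simp
      finally have "emeasure I {s<..b} \<noteq> 0" by simp
      moreover have "AE t in I. t \<notin> {s<..b}"
        using carried by eventually_elim (use pos in auto)
      then have "{s<..b} \<in> null_sets I"
        by (subst AE_iff_null_sets) (auto simp: I_def)
      ultimately show False by auto
    qed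
  qed
  then have "Z s \<in> null_sets P" using Z_sets[OF s] by (simp add: AE_iff_null_sets)
  then show ?thesis by (simp add: measure_eq_0_null_sets)
qed

lemma X_filterlim_at_top:
  assumes A: "AE \<omega> in P. filterlim (\<lambda>t. A t \<omega>) at_top at_top" and s: "0 \<le> s"
  shows "AE \<omega> in Q. \<omega> \<in> Z s \<longrightarrow> filterlim (\<lambda>t. X t \<omega>) at_top at_top"
proof -
  define S where "S K t = {\<omega>\<in>space P. X t \<omega> < K}" for K t :: real
  have S: "S K t \<in> sets (G t)" if "0 \<le> t" for K t unfolding S_def using that by (rule X_less_sets)
  have L: "limsup_rat (S K) \<in> sets P" for K using limsup_rat_sets[OF filt S] .
  have "AE \<omega> in Q. \<omega> \<in> Z s \<longrightarrow> \<omega> \<notin> Z s \<inter> limsup_rat (S K)" if "0 \<le> K" for K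
  proof (rule AE_\<nu>_imp)
    \<comment> \<open>The set \<open>Z s\<close> carries \<open>\<nu> s\<close> and is
      \<open>P\<close>-null, so the right-hand side vanishes for every \<open>K\<close>.\<close>
    have "measure (\<nu> s) (Z s \<inter> limsup_rat (S K)) \<le> K * measure P (Z s)"
      using s that S Z_sets P.finite_measure_axioms
      by (intro measure_\<nu>_limsup_rat_le integral_X_le) (auto simp: S_def)
    then show "measure (\<nu> s) (Z s \<inter> limsup_rat (S K)) = 0"
      using Z_null[OF A s] measure_nonneg[of "\<nu> s" "Z s \<inter> limsup_rat (S K)"] by simp
  qed (use s Z_sets L in auto)
  then have "AE \<omega> in Q. \<forall>K::nat. \<omega> \<in> Z s \<longrightarrow> \<omega> \<notin> limsup_rat (S (real K))"
    unfolding AE_all_countable by auto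
  then show ?thesis
    using AE_space
  proof eventually_elim
    fix \<omega> assume L: "\<forall>K::nat. \<omega> \<in> Z s \<longrightarrow> \<omega> \<notin> limsup_rat (S (real K))" and \<omega>: "\<omega> \<in> space Q"
    have ev: "\<forall>\<^sub>F t in at_top. real K \<le> X t \<omega>" if Zs: "\<omega> \<in> Z s" for K
    proof -
      obtain n :: nat where n: "\<And>t. t \<in> \<rat> \<Longrightarrow> real n \<le> t \<Longrightarrow> real K \<le> X t \<omega>"
        using L[rule_format, OF Zs, of K] \<omega> by (auto simp: not_in_limsup_rat S_def not_less)
      have "0 \<le> X t \<omega> - real K" if t: "real n \<le> t" for t
      proof (rule right_continuous_nonneg[of "\<lambda>t. X t \<omega> - real K"])
        show "((\<lambda>t. X t \<omega> - real K) \<longlongrightarrow> X t \<omega> - real K) (at_right t)"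
          using \<omega> order_trans[OF of_nat_0_le_iff t] by (intro tendsto_intros X_right_continuous) auto
      qed (use n t in auto)
      then show ?thesis by (auto simp: eventually_at_top_linorder)
    qed
    have "\<forall>\<^sub>F t in at_top. c \<le> X t \<omega>" if "\<omega> \<in> Z s" for c
    proof -
      obtain K :: nat where "c \<le> real K" using real_arch_simple by blast
      with ev[OF that, of K] show ?thesis by (elim eventually_mono) simp
    qed
    then show "\<omega> \<in> Z s \<longrightarrow> filterlim (\<lambda>t. X t \<omega>) at_top at_top"
      by (simp add: filterlim_at_top)
  qed
qed

text \<open>The sets \<open>Z n\<close> exhaust the space up to a \<open>Q\<close>-null set because
  the last zero is finite \<open>Q\<close>-almost everywhere. This reduces claims about
  \<open>Q\<close> to its finite restrictions.\<close>

lemma AE_Z: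
  assumes "\<And>s::nat. AE \<omega> in Q. \<omega> \<in> Z (real s) \<longrightarrow> R \<omega>"
  shows "AE \<omega> in Q. R \<omega>"
proof -
  have "AE \<omega> in Q. \<forall>s::nat. \<omega> \<in> Z (real s) \<longrightarrow> R \<omega>"
    unfolding AE_all_countable using assms by blast
  moreover have "AE \<omega> in Q. last_zero X \<omega> \<noteq> \<infinity>"
    using ass by (simp add: associated_measure_def)
  ultimately show ?thesis
    using AE_space
  proof eventually_elim
    fix \<omega> assume R: "\<forall>s::nat. \<omega> \<in> Z (real s) \<longrightarrow> R \<omega>"
      and g: "last_zero X \<omega> \<noteq> \<infinity>" and \<omega>: "\<omega> \<in> space Q"
    obtain s :: nat where "last_zero X \<omega> \<le> ennreal (real s)"
      using g ennreal_Ex_less_of_nat[of "last_zero X \<omega>"]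
      by (auto simp: less_top ennreal_of_nat_eq_real_of_nat intro: less_imp_le)
    with R \<omega> show "R \<omega>" by (auto simp: Z_def)
  qed
qed

section \<open>Paths that approach zero after a given time\<close>

text \<open>A measurable substitute for the event that \<open>X\<close> vanishes at some time of
  \<open>I\<close> after \<open>s\<close>, which would be an uncountable union. With
  \<open>I = {..t}\<close> it belongs to \<open>G t\<close>; with \<open>I = UNIV\<close> it is
  shown to be null.\<close>

definition near_zero :: "real \<Rightarrow> real set \<Rightarrow> 'a set" where
  "near_zero s I = (\<Inter>n::nat. \<Union>u\<in>\<rat> \<inter> {s<..} \<inter> I. {\<omega>\<in>space P. X u \<omega> < 1 / (real n + 1)})"

lemma near_zero_mono: "I \<subseteq> J \<Longrightarrow> near_zero s I \<subseteq> near_zero s J"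
  unfolding near_zero_def by blast

lemma near_zero_sets:
  assumes "0 \<le> s" "s \<le> t"
  shows "near_zero s {..t} \<in> sets (G t)"
proof -
  have "countable (\<rat> \<inter> {s<..} \<inter> {..t})" using countable_rat by blast
  moreover have "{\<omega>\<in>space P. X u \<omega> < c} \<in> sets (G t)" if "u \<in> {s<..} \<inter> {..t}" for u c
    using X_less_sets[of u c] filtered_space_mono[OF filt, of u t] that assms by auto
  ultimately show ?thesis
    unfolding near_zero_def by (intro sets.countable_INT sets.countable_UN') auto
qed

lemma near_zero_sets_UNIV:
  assumes "0 \<le> s"
  shows "near_zero s UNIV \<in> sets P"
proof -
  have "countable (\<rat> \<inter> {s<..} \<inter> UNIV)" using countable_rat by blast
  moreover have "{\<omega>\<in>space P. X u \<omega> < c} \<in> sets P" if "u \<in> {s<..}" for u c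
    using G_sets[OF _ X_less_sets[of u c]] that assms by auto
  ultimately show ?thesis
    unfolding near_zero_def by (intro sets.countable_INT sets.countable_UN') auto
qed

text \<open>By first passage, the mass of the paths of \<open>{g \<le> s}\<close> that fall below \<open>c\<close> after time \<open>s\<close>
  is at most \<open>c\<close>.\<close>

lemma near_zero_null:
  assumes s: "0 \<le> s"
  shows "measure (\<nu> s) (near_zero s UNIV) = 0"
proof -
  interpret \<nu>: finite_measure "\<nu> s" by (rule finite_\<nu>[OF s])
  define S where "S n u = {\<omega>\<in>space P. X u \<omega> < 1 / (real n + 1)}" for n u
  define R where "R = \<rat> \<inter> {s<..}"
  have cR: "countable R" unfolding R_def using countable_rat by blast
  have R: "R \<subseteq> {s..}" unfolding R_def by auto
  have SG: "S n u \<in> sets (G u)" if "u \<in> R" for n u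
    unfolding S_def using that s by (intro X_less_sets) (auto simp: R_def)
  have le: "measure (\<nu> s) (near_zero s UNIV) \<le> 1 / (real n + 1)" for n
  proof -
    have "S n u \<in> sets P" if "u \<in> R" for u
      using G_sets[OF _ SG[OF that]] that s by (auto simp: R_def)
    then have "(\<Union>u\<in>R. S n u) \<in> sets P" using cR by (intro sets.countable_UN') auto
    then have "measure (\<nu> s) (near_zero s UNIV) \<le> measure (\<nu> s) (space P \<inter> (\<Union>u\<in>R. S n u))"
      by (intro \<nu>.finite_measure_mono) (auto simp: near_zero_def R_def S_def)
    also have "\<dots> \<le> 1 / (real n + 1) * measure P (space P)"
    proof (rule first_passage[OF \<nu>.finite_measure_axioms P.finite_measure_axioms _ filtered_\<nu> s _ cR R SG])
      show "space P \<in> sets (G s)"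
        using sets.top[of "G s"] filtered_space_space[OF filt s] by simp
      fix u C assume u: "u \<in> R" and C: "C \<in> sets (G u)" "C \<subseteq> S n u"
      have "0 \<le> u" "s \<le> u" using u s by (auto simp: R_def)
      then show "measure (\<nu> s) C \<le> 1 / (real n + 1) * measure P C"
        using measure_\<nu>_le[OF s _ C(1)] integral_X_le[OF _ C(1), of "1 / (real n + 1)"] C(2)
        by (fastforce simp: S_def)
    qed auto
    finally show ?thesis using P.prob_space by simp
  qed
  have "measure (\<nu> s) (near_zero s UNIV) \<le> 0"
  proof (rule field_le_epsilon)
    fix e :: real assume "0 < e"
    then obtain n where "inverse (real (Suc n)) < e" using reals_Archimedean by blast
    then show "measure (\<nu> s) (near_zero s UNIV) \<le> 0 + e"
      using le[of n] by (simp add: inverse_eq_divide add.commute)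
  qed
  then show ?thesis using measure_nonneg[of "\<nu> s"] by (simp add: antisym)
qed

text \<open>Away from \<open>near_zero s {..t}\<close> there is no zero in \<open>{s<..t}\<close>.\<close>

lemma Z_subset_Z:
  assumes s: "0 \<le> s" and t: "t \<in> \<rat>"
  shows "Z t - near_zero s {..t} \<subseteq> Z s"
proof
  fix \<omega> assume "\<omega> \<in> Z t - near_zero s {..t}"
  then have \<omega>: "\<omega> \<in> space P" "last_zero X \<omega> \<le> ennreal t" and nz: "\<omega> \<notin> near_zero s {..t}"
    by (auto simp: Z_def)
  obtain n :: nat where n: "\<And>u. u \<in> \<rat> \<Longrightarrow> s < u \<Longrightarrow> u \<le> t \<Longrightarrow> 1 / (real n + 1) \<le> X u \<omega>"
    using nz \<omega> by (auto simp: near_zero_def not_less)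
  have "u \<le> s" if u: "0 \<le> u" "X u \<omega> = 0" for u
  proof (rule ccontr)
    assume "\<not> u \<le> s"
    then have su: "s < u" by simp
    have "ennreal u \<le> last_zero X \<omega>"
      unfolding last_zero_def using u by (intro SUP_upper) auto
    then have "ennreal u \<le> ennreal t" using \<omega> by simp
    \<comment> \<open>For negative \<open>t\<close> the value \<open>ennreal t\<close> is
      \<open>0\<close>, which is incompatible with \<open>0 < u\<close>.\<close>
    then have "u \<le> t" using su s by (cases "t < 0") (auto simp: ennreal_le_iff2)
    \<comment> \<open>Here the rationality of \<open>t\<close> matters: the lower bound on
      \<open>X\<close> holds at \<open>t\<close> itself, which excludes a zero there.\<close>
    then have "u < t" using n[of t] t u su by (cases "u = t") auto
    have "0 \<le> X u \<omega> - 1 / (real n + 1)"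
    proof (rule ccontr)
      assume "\<not> 0 \<le> X u \<omega> - 1 / (real n + 1)"
      then have "\<forall>\<^sub>F v in at_right u. X v \<omega> < 1 / (real n + 1)"
        using X_right_continuous[OF u(1) \<omega>(1)] by (intro order_tendstoD(2)) auto
      then obtain b where b: "u < b" "\<And>v. u < v \<Longrightarrow> v < b \<Longrightarrow> X v \<omega> < 1 / (real n + 1)"
        unfolding eventually_at_right_field by blast
      \<comment> \<open>Staying below \<open>t\<close> keeps \<open>v\<close> among the times at
        which the lower bound \<open>n\<close> applies.\<close>
      obtain v where "v \<in> \<rat>" "u < v" "v < min b t"
        using Rats_dense_in_real[of u "min b t"] b(1) \<open>u < t\<close> by auto
      then show False using b(2)[of v] n[of v] su by auto
    qed
    then show False using u by (simp add: field_simps)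
  qed
  then have "last_zero X \<omega> \<le> ennreal s"
    unfolding last_zero_def by (intro SUP_least ennreal_leI) auto
  then show "\<omega> \<in> Z s" using \<omega> by (simp add: Z_def)
qed

end

section \<open>The measure \<open>F.Q\<close> and its density process\<close>

locale class_Sigma_functional = class_Sigma_space P Q G X N A
  for P Q :: "'a measure" and G X N A +
  fixes F :: "'a \<Rightarrow> real" and M :: "real \<Rightarrow> 'a \<Rightarrow> real"
  assumes F_integrable: "integrable Q F"
    and F_nonneg: "\<And>\<omega>. \<omega> \<in> space P \<Longrightarrow> 0 \<le> F \<omega>"
    and M: "associated_martingale P G Q F M"
begin

lemma F_measurable [measurable]: "F \<in> borel_measurable P"
  using borel_measurable_integrable[OF F_integrable] measurable_cong_sets[OF sets_Q refl] by blast

lemma M_adapted: "0 \<le> t \<Longrightarrow> M t \<in> borel_measurable (G t)"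
  using M by (simp add: associated_martingale_def martingale_def adapted_def)

lemma M_integrable: "0 \<le> t \<Longrightarrow> integrable P (M t)"
  using M by (simp add: associated_martingale_def martingale_def)

lemma M_right_continuous:
  "0 \<le> t \<Longrightarrow> \<omega> \<in> space P \<Longrightarrow> ((\<lambda>t. M t \<omega>) \<longlongrightarrow> M t \<omega>) (at_right t)"
  using M by (simp add: associated_martingale_def cadlag_def)

lemma integrable_M_on:
  assumes "0 \<le> t" "C \<in> sets (G t)"
  shows "integrable P (\<lambda>\<omega>. indicator C \<omega> * M t \<omega>)"
  using integrable_mult_indicator[OF G_sets[OF assms] M_integrable[OF assms(1)]] by simp

definition \<mu> :: "'a measure" where
  "\<mu> = density Q (\<lambda>\<omega>. ennreal (F \<omega>))"

lemma sets_\<mu> [simp, measurable_cong]: "sets \<mu> = sets P"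
  by (simp add: \<mu>_def)

lemma space_\<mu> [simp]: "space \<mu> = space P"
  by (simp add: \<mu>_def)

lemma finite_\<mu>: "finite_measure \<mu>"
proof (rule finite_measureI)
  have "emeasure \<mu> (space \<mu>) = (\<integral>\<^sup>+\<omega>. ennreal (F \<omega>) \<partial>Q)"
    unfolding \<mu>_def by (subst emeasure_density) (auto intro!: nn_integral_cong)
  also have "\<dots> = ennreal (\<integral>\<omega>. F \<omega> \<partial>Q)"
    using F_nonneg by (intro nn_integral_eq_integral F_integrable) auto
  finally show "emeasure \<mu> (space \<mu>) \<noteq> \<infinity>" by simp
qed

lemma measure_\<mu>: "C \<in> sets P \<Longrightarrow> measure \<mu> C = (\<integral>\<omega>. indicator C \<omega> * F \<omega> \<partial>Q)"
proof -
  assume C: "C \<in> sets P"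
  have "measure \<mu> C = (\<integral>\<omega>. indicator C \<omega> \<partial>\<mu>)"
    using sets.sets_into_space[OF C] by (simp add: Int_absorb2)
  also have "\<dots> = (\<integral>\<omega>. F \<omega> *\<^sub>R indicator C \<omega> \<partial>Q)"
    unfolding \<mu>_def using C F_nonneg by (intro integral_density) auto
  finally show ?thesis by (simp add: mult.commute)
qed

text \<open>The indicator of \<open>C\<close> is an admissible test function for \<open>M\<close>.
  Thus \<open>M t\<close> is the density of \<open>\<mu>\<close> with respect to \<open>P\<close> on
  \<open>G t\<close>, the counterpart of \<open>X t\<close> for \<open>\<nu> s\<close>.\<close>

lemma measure_\<mu>_eq_M:
  assumes "0 \<le> t" "C \<in> sets (G t)"
  shows "measure \<mu> C = (\<integral>\<omega>. indicator C \<omega> * M t \<omega> \<partial>P)"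
proof -
  have "bounded_rv (G t) (indicator C)"
    unfolding bounded_rv_def using assms
    by (auto intro!: boundedI[of _ 1] simp: indicator_def)
  then have "(\<integral>\<omega>. F \<omega> * indicator C \<omega> \<partial>Q) = (\<integral>\<omega>. indicator C \<omega> * M t \<omega> \<partial>P)"
    using M assms by (simp add: associated_martingale_def)
  then show ?thesis using measure_\<mu>[OF G_sets[OF assms]] by (simp add: mult.commute)
qed

lemma integrable_F_on: "C \<in> sets P \<Longrightarrow> integrable Q (\<lambda>\<omega>. indicator C \<omega> * F \<omega>)"
  using integrable_mult_indicator[OF _ F_integrable, of C] by simp

lemma finite_on_Z:
  assumes "0 \<le> s" "B \<in> sets P" "B \<subseteq> Z s"
  shows "integrable Q (\<lambda>\<omega>. indicator B \<omega> * (h::real))"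
    and "(\<integral>\<omega>. indicator B \<omega> * h \<partial>Q) = h * measure (\<nu> s) B"
proof -
  have "emeasure Q B < \<infinity>"
    using emeasure_mono[OF assms(3), of Q] Z_sets[OF assms(1)] Z_finite[OF assms(1)]
    by (simp add: order_le_less_trans)
  then show "integrable Q (\<lambda>\<omega>. indicator B \<omega> * h)"
    using assms by simp
  show "(\<integral>\<omega>. indicator B \<omega> * h \<partial>Q) = h * measure (\<nu> s) B"
    using assms sets.sets_into_space[OF assms(2)]
    by (simp add: measure_\<nu> Int_absorb1 Int_absorb2)
qed

section \<open>Upper and lower limits of the ratio\<close>

text \<open>As in the differentiation of measures: on \<open>B = {F < h} \<inter> Z s \<inter> limsup {h X < M}\<close> the bound
  \<open>h \<Q>[B] \<le> \<Q>[F 1\<^sub>B]\<close> forces \<open>\<Q>[B] = 0\<close>; symmetrically for the lower limit.\<close>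

lemma limsup_ratio_le:
  assumes s: "0 \<le> s" and h: "0 < h"
  shows "AE \<omega> in Q. \<omega> \<in> Z s \<longrightarrow> F \<omega> < h \<longrightarrow> \<omega> \<notin> limsup_rat (\<lambda>t. {\<omega>\<in>space P. h * X t \<omega> < M t \<omega>})"
proof -
  define S where "S t = {\<omega>\<in>space P. h * X t \<omega> < M t \<omega>}" for t
  have S: "S t \<in> sets (G t)" if t: "0 \<le> t" for t
  proof -
    have "(\<lambda>\<omega>. h * X t \<omega>) \<in> borel_measurable (G t)"
      using X_adapted[OF t] by measurable
    then show ?thesis
      using borel_measurable_less[OF _ M_adapted[OF t]] filtered_space_space[OF filt t]
      by (simp add: S_def)
  qed
  define B where "B = {\<omega>\<in>space P. F \<omega> < h} \<inter> Z s \<inter> limsup_rat S"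
  have B: "B \<in> sets P"
    unfolding B_def using Z_sets[OF s] limsup_rat_sets[OF filt S] by measurable
  note fin = finite_on_Z[OF s B]
  have BZ: "B \<subseteq> Z s" by (auto simp: B_def)
  have "measure (\<nu> s) (B \<inter> limsup_rat S) \<le> 1 / h * measure \<mu> B"
  proof (rule measure_\<nu>_limsup_rat_le[OF finite_\<mu> sets_\<mu> s _ S _ B])
    fix t C assume t: "s \<le> t" and C: "C \<in> sets (G t)" "C \<subseteq> S t"
    have t0: "0 \<le> t" using s t by simp
    have "h * (\<integral>\<omega>. indicator C \<omega> * X t \<omega> \<partial>P) = (\<integral>\<omega>. h * (indicator C \<omega> * X t \<omega>) \<partial>P)"
      by simp
    also have "\<dots> \<le> (\<integral>\<omega>. indicator C \<omega> * M t \<omega> \<partial>P)"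
      using C integrable_X_on[OF t0 C(1)] integrable_M_on[OF t0 C(1)]
      by (intro integral_mono) (auto simp: S_def indicator_def subset_iff)
    also have "\<dots> = measure \<mu> C" using measure_\<mu>_eq_M[OF t0 C(1)] by simp
    finally show "(\<integral>\<omega>. indicator C \<omega> * X t \<omega> \<partial>P) \<le> 1 / h * measure \<mu> C"
      using h by (simp add: field_simps)
  qed (use h in auto)
  \<comment> \<open>\<open>B\<close> lies inside \<open>limsup_rat S\<close>, so intersecting with
    it changes nothing.\<close>
  then have le: "h * measure (\<nu> s) B \<le> (\<integral>\<omega>. indicator B \<omega> * F \<omega> \<partial>Q)"
    using h measure_\<mu>[OF B] by (simp add: B_def Int_assoc field_simps)
  have "B \<in> null_sets Q"
  proof (rule null_sets_of_integral_nonpos[where f = "\<lambda>\<omega>. h - F \<omega>"])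
    show "integrable Q (\<lambda>\<omega>. indicator B \<omega> * (h - F \<omega>))"
      unfolding right_diff_distrib using fin(1)[OF BZ] integrable_F_on[OF B]
      by (rule Bochner_Integration.integrable_diff)
    show "(\<integral>\<omega>. indicator B \<omega> * (h - F \<omega>) \<partial>Q) \<le> 0"
      unfolding right_diff_distrib
        Bochner_Integration.integral_diff[OF fin(1)[OF BZ] integrable_F_on[OF B]]
        fin(2)[OF BZ]
      using le by simp
  qed (use B in \<open>auto simp: B_def\<close>)
  then show ?thesis
    by (rule AE_mp[OF AE_not_in]) (auto simp: B_def S_def[abs_def])
qed

lemma liminf_ratio_ge:
  assumes s: "0 \<le> s" and h: "0 < h"
  shows "AE \<omega> in Q. \<omega> \<in> Z s \<longrightarrow> h < F \<omega> \<longrightarrow> \<omega> \<notin> limsup_rat (\<lambda>t. {\<omega>\<in>space P. M t \<omega> < h * X t \<omega>})"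
proof -
  \<comment> \<open>The empty set before time \<open>s\<close> keeps \<open>S t\<close> in
    \<open>G t\<close>, as \<open>near_zero_sets\<close> covers \<open>s \<le> t\<close>; finite
    times do not affect the upper limit.\<close>
  define S where "S t = (if s \<le> t then {\<omega>\<in>space P. M t \<omega> < h * X t \<omega>} - near_zero s {..t} else {})" for t
  have S: "S t \<in> sets (G t)" if t: "0 \<le> t" for t
  proof -
    have "(\<lambda>\<omega>. h * X t \<omega>) \<in> borel_measurable (G t)"
      using X_adapted[OF t] by measurable
    then show ?thesis
      using borel_measurable_less[OF M_adapted[OF t]] filtered_space_space[OF filt t]
        near_zero_sets[OF s, of t]
      by (auto simp: S_def intro!: sets.Diff)
  qed
  define B where "B = {\<omega>\<in>space P. h < F \<omega>} \<inter> Z s \<inter> limsup_rat S"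
  have B: "B \<in> sets P"
    unfolding B_def using Z_sets[OF s] limsup_rat_sets[OF filt S] by measurable
  note fin = finite_on_Z[OF s B]
  have BZ: "B \<subseteq> Z s" by (auto simp: B_def)
  have filt_\<mu>: "filtered_space \<mu> G"
    using filt by (simp add: filtered_space_def subalgebra_def)
  have gen_\<mu>: "sets \<mu> = sigma_sets (space \<mu>) (\<Union>t\<in>{0..}. sets (G t))"
    using gen by simp
  have "measure \<mu> (B \<inter> limsup_rat S) \<le> h * measure (\<nu> s) B"
  proof (rule measure_limsup_rat_le[OF finite_\<mu> finite_\<nu>[OF s] _ filt_\<mu> gen_\<mu> _ s S])
    fix t C assume t: "t \<in> \<rat>" "s \<le> t" and C: "C \<in> sets (G t)" "C \<subseteq> S t"
    have t0: "0 \<le> t" using s t by simp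
    have "measure \<mu> C = (\<integral>\<omega>. indicator C \<omega> * M t \<omega> \<partial>P)" using measure_\<mu>_eq_M[OF t0 C(1)] .
    also have "\<dots> \<le> (\<integral>\<omega>. h * (indicator C \<omega> * X t \<omega>) \<partial>P)"
      using C t integrable_X_on[OF t0 C(1)] integrable_M_on[OF t0 C(1)]
      by (intro integral_mono) (auto simp: S_def indicator_def subset_iff)
    also have "\<dots> = h * measure Q (Z t \<inter> C)" using measure_Z[OF t0 C(1)] by simp
    \<comment> \<open>Off \<open>near_zero s {..t}\<close> the sets \<open>Z t\<close> and
      \<open>Z s\<close> agree for rational \<open>t\<close>. This turns a bound by
      \<open>X t\<close> into one by the fixed measure \<open>\<nu> s\<close>.\<close>
    also have "Z t \<inter> C = Z s \<inter> C"
      using Z_subset_Z[OF s t(1)] Z_mono[OF t(2)] C(2) t(2) by (auto simp: S_def)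
    also have "measure Q (Z s \<inter> C) = measure (\<nu> s) C"
      using measure_\<nu>[OF s G_sets[OF t0 C(1)]] by simp
    finally show "measure \<mu> C \<le> h * measure (\<nu> s) C" .
  qed (use h B in auto)
  then have le: "(\<integral>\<omega>. indicator B \<omega> * F \<omega> \<partial>Q) \<le> h * measure (\<nu> s) B"
    using measure_\<mu>[OF B] by (simp add: B_def Int_assoc)
  have "B \<in> null_sets Q"
  proof (rule null_sets_of_integral_nonpos[where f = "\<lambda>\<omega>. F \<omega> - h"])
    show "integrable Q (\<lambda>\<omega>. indicator B \<omega> * (F \<omega> - h))"
      unfolding right_diff_distrib using integrable_F_on[OF B] fin(1)[OF BZ]
      by (rule Bochner_Integration.integrable_diff)
    show "(\<integral>\<omega>. indicator B \<omega> * (F \<omega> - h) \<partial>Q) \<le> 0"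
      unfolding right_diff_distrib
        Bochner_Integration.integral_diff[OF integrable_F_on[OF B] fin(1)[OF BZ]] fin(2)[OF BZ]
      using le by simp
  qed (use B in \<open>auto simp: B_def\<close>)
  then have "AE \<omega> in Q. \<omega> \<notin> B" by (rule AE_not_in)
  moreover have "AE \<omega> in Q. \<omega> \<in> Z s \<longrightarrow> \<omega> \<notin> near_zero s UNIV"
    using AE_\<nu>_imp[OF s near_zero_sets_UNIV[OF s] near_zero_null[OF s]] .
  ultimately show ?thesis
    using AE_space
  proof eventually_elim
    fix \<omega> assume \<omega>: "\<omega> \<notin> B" "\<omega> \<in> Z s \<longrightarrow> \<omega> \<notin> near_zero s UNIV" "\<omega> \<in> space Q"
    show "\<omega> \<in> Z s \<longrightarrow> h < F \<omega> \<longrightarrow> \<omega> \<notin> limsup_rat (\<lambda>t. {\<omega>\<in>space P. M t \<omega> < h * X t \<omega>})"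
    proof (intro impI)
      assume Z: "\<omega> \<in> Z s" and "h < F \<omega>"
      then have "\<omega> \<notin> limsup_rat S" using \<omega> by (auto simp: B_def)
      then obtain n :: nat where n: "\<And>t. t \<in> \<rat> \<Longrightarrow> real n \<le> t \<Longrightarrow> \<omega> \<notin> S t"
        by (auto simp: not_in_limsup_rat)
      obtain m :: nat where m: "s \<le> real m" using real_arch_simple by blast
      \<comment> \<open>Hence the removed event is invisible at this \<open>\<omega>\<close>, and
        from time \<open>s\<close> on \<open>S t\<close> can be replaced by the full event.\<close>
      have "\<omega> \<notin> near_zero s {..t}" for t
        using \<omega> Z near_zero_mono[of "{..t}" UNIV s] by auto
      then have "\<omega> \<notin> {\<omega>\<in>space P. M t \<omega> < h * X t \<omega>}" if "t \<in> \<rat>" "real (max m n) \<le> t" for t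
        using n[of t] m that by (auto simp: S_def of_nat_max)
      then show "\<omega> \<notin> limsup_rat (\<lambda>t. {\<omega>\<in>space P. M t \<omega> < h * X t \<omega>})"
        unfolding not_in_limsup_rat by blast
    qed
  qed
qed

text \<open>The integral of \<open>M t\<close> over \<open>{M t < 0}\<close> equals the mass of that
  event under \<open>\<mu>\<close>, which is nonnegative, so the event is \<open>P\<close>-null. It
  is then null for \<open>\<nu> s\<close>, whose restriction to \<open>G t\<close> is dominated by
  the density \<open>X t\<close>.\<close>

lemma M_nonneg:
  assumes s: "0 \<le> s" and t: "s \<le> t"
  shows "AE \<omega> in Q. \<omega> \<in> Z s \<longrightarrow> 0 \<le> M t \<omega>"
proof -
  have t0: "0 \<le> t" using assms by simp
  define C where "C = {\<omega>\<in>space P. M t \<omega> < 0}"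
  have C: "C \<in> sets (G t)"
    unfolding C_def using borel_measurable_less[OF M_adapted[OF t0] borel_measurable_const, of 0]
    by (simp add: filtered_space_space[OF filt t0])
  have "0 \<le> (\<integral>\<omega>. indicator C \<omega> * M t \<omega> \<partial>P)"
    using measure_\<mu>_eq_M[OF t0 C] measure_nonneg[of \<mu> C] by simp
  then have "C \<in> null_sets P"
    using integrable_M_on[OF t0 C] G_sets[OF t0 C]
    by (intro null_sets_of_integral_nonpos[where f = "\<lambda>\<omega>. - M t \<omega>"]) (auto simp: C_def)
  then have "AE \<omega> in P. \<omega> \<notin> C" by (rule AE_not_in)
  then have "AE \<omega> in P. indicator C \<omega> * X t \<omega> = 0" by eventually_elim simp
  then have "(\<integral>\<omega>. indicator C \<omega> * X t \<omega> \<partial>P) = 0" by (rule integral_eq_zero_AE)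
  then have "measure (\<nu> s) C = 0"
    using measure_\<nu>_le[OF s t C] measure_nonneg[of "\<nu> s" C] by simp
  then have "AE \<omega> in Q. \<omega> \<in> Z s \<longrightarrow> \<omega> \<notin> C"
    by (intro AE_\<nu>_imp[OF s G_sets[OF t0 C]])
  then show ?thesis
    using AE_space by eventually_elim (auto simp: C_def not_less)
qed

section \<open>Convergence of the ratio\<close>

text \<open>A deterministic argument for one path: rational levels \<open>h\<close> squeeze the
  ratio at rational times, right-continuity extends this to all times, and \<open>X\<close> is
  eventually positive, which permits division. As \<open>lower\<close> concerns positive levels,
  lower bounds by negative \<open>a\<close> come from \<open>nn\<close>.\<close>

lemma ratio_tendsto_pointwise:
  assumes \<omega>: "\<omega> \<in> space P" and lim: "filterlim (\<lambda>t. X t \<omega>) at_top at_top"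
    and upper: "\<And>h. h \<in> \<rat> \<Longrightarrow> F \<omega> < h \<Longrightarrow> \<omega> \<notin> limsup_rat (\<lambda>t. {\<omega>\<in>space P. h * X t \<omega> < M t \<omega>})"
    and lower: "\<And>h. h \<in> \<rat> \<Longrightarrow> 0 < h \<Longrightarrow> h < F \<omega> \<Longrightarrow> \<omega> \<notin> limsup_rat (\<lambda>t. {\<omega>\<in>space P. M t \<omega> < h * X t \<omega>})"
    and nn: "\<And>t. t \<in> \<rat> \<Longrightarrow> s \<le> t \<Longrightarrow> 0 \<le> M t \<omega>" and s: "0 \<le> s"
  shows "((\<lambda>t. M t \<omega> / X t \<omega>) \<longlongrightarrow> F \<omega>) at_top"
proof (rule order_tendstoI)
  have Xpos: "\<forall>\<^sub>F t in at_top. 0 < X t \<omega>"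
    using lim by (simp add: filterlim_at_top_dense)
  fix a
  {
    assume "a < F \<omega>"
    show "\<forall>\<^sub>F t in at_top. a < M t \<omega> / X t \<omega>"
    proof (cases "a < 0")
      case True
      have "0 \<le> M t \<omega>" if "s \<le> t" for t
      proof (rule right_continuous_nonneg[of "\<lambda>t. M t \<omega>"])
        show "((\<lambda>t. M t \<omega>) \<longlongrightarrow> M t \<omega>) (at_right t)"
          using that s \<omega> by (intro M_right_continuous) auto
      qed (use nn that in auto)
      then have "\<forall>\<^sub>F t in at_top. 0 \<le> M t \<omega>"
        unfolding eventually_at_top_linorder by blast
      with Xpos show ?thesis
      proof eventually_elim
        case (elim t)
        then have "0 \<le> M t \<omega> / X t \<omega>" by simp
        with True show ?case by linarith
      qed
    next
      case False
      obtain h where h: "h \<in> \<rat>" "a < h" "h < F \<omega>" using Rats_dense_in_real[OF \<open>a < F \<omega>\<close>] by blast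
      then have "0 < h" using False by simp
      obtain n :: nat where n: "\<And>t. t \<in> \<rat> \<Longrightarrow> real n \<le> t \<Longrightarrow> h * X t \<omega> \<le> M t \<omega>"
        using lower[OF h(1) \<open>0 < h\<close> h(3)] \<omega> by (auto simp: not_in_limsup_rat not_less)
      have "0 \<le> M t \<omega> - h * X t \<omega>" if t: "real n \<le> t" for t
      proof (rule right_continuous_nonneg[of "\<lambda>t. M t \<omega> - h * X t \<omega>"])
        show "((\<lambda>t. M t \<omega> - h * X t \<omega>) \<longlongrightarrow> M t \<omega> - h * X t \<omega>) (at_right t)"
          using \<omega> order_trans[OF of_nat_0_le_iff t]
          by (intro tendsto_intros M_right_continuous X_right_continuous)
      qed (use n t in auto)
      then have "\<forall>\<^sub>F t in at_top. h * X t \<omega> \<le> M t \<omega>"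
        unfolding eventually_at_top_linorder by fastforce
      with Xpos show ?thesis
      proof eventually_elim
        case (elim t)
        then have "h \<le> M t \<omega> / X t \<omega>" by (simp add: field_simps)
        with h(2) show ?case by simp
      qed
    qed
  next
    assume "F \<omega> < a"
    then obtain h where h: "h \<in> \<rat>" "F \<omega> < h" "h < a" using Rats_dense_in_real by blast
    obtain n :: nat where n: "\<And>t. t \<in> \<rat> \<Longrightarrow> real n \<le> t \<Longrightarrow> M t \<omega> \<le> h * X t \<omega>"
      using upper[OF h(1,2)] \<omega> by (auto simp: not_in_limsup_rat not_less)
    have "0 \<le> h * X t \<omega> - M t \<omega>" if t: "real n \<le> t" for t
    proof (rule right_continuous_nonneg[of "\<lambda>t. h * X t \<omega> - M t \<omega>"])
      show "((\<lambda>t. h * X t \<omega> - M t \<omega>) \<longlongrightarrow> h * X t \<omega> - M t \<omega>) (at_right t)"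
        using \<omega> order_trans[OF of_nat_0_le_iff t]
        by (intro tendsto_intros M_right_continuous X_right_continuous)
    qed (use n t in auto)
    then have "\<forall>\<^sub>F t in at_top. M t \<omega> \<le> h * X t \<omega>"
      unfolding eventually_at_top_linorder by fastforce
    with Xpos show "\<forall>\<^sub>F t in at_top. M t \<omega> / X t \<omega> < a"
    proof eventually_elim
      case (elim t)
      then have "M t \<omega> / X t \<omega> \<le> h" by (simp add: field_simps)
      with h(3) show ?case by simp
    qed
  }
qed

text \<open>On each \<open>Z s\<close> the exceptional sets for the countably many rational levels
  and times are united into one null set. Positive levels suffice for the upper bound because
  \<open>F < h\<close> and \<open>0 \<le> F\<close> force \<open>0 < h\<close>.\<close>

lemma ratio_tendsto:
  assumes A: "AE \<omega> in P. filterlim (\<lambda>t. A t \<omega>) at_top at_top"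
  shows "AE \<omega> in Q. ((\<lambda>t. M t \<omega> / X t \<omega>) \<longlongrightarrow> F \<omega>) at_top"
proof (rule AE_Z)
  fix n :: nat
  define s where "s = real n"
  have s: "0 \<le> s" by (simp add: s_def)
  have c: "countable (\<rat> \<inter> {0<..} :: real set)" "countable (\<rat> \<inter> {s..})"
    using countable_rat by blast+
  have "AE \<omega> in Q. \<forall>h\<in>\<rat> \<inter> {0<..}. \<omega> \<in> Z s \<longrightarrow> F \<omega> < h \<longrightarrow>
      \<omega> \<notin> limsup_rat (\<lambda>t. {\<omega>\<in>space P. h * X t \<omega> < M t \<omega>})"
    unfolding AE_ball_countable[OF c(1)] using limsup_ratio_le[OF s] by simp
  moreover have "AE \<omega> in Q. \<forall>h\<in>\<rat> \<inter> {0<..}. \<omega> \<in> Z s \<longrightarrow> h < F \<omega> \<longrightarrow>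
      \<omega> \<notin> limsup_rat (\<lambda>t. {\<omega>\<in>space P. M t \<omega> < h * X t \<omega>})"
    unfolding AE_ball_countable[OF c(1)] using liminf_ratio_ge[OF s] by simp
  moreover have "AE \<omega> in Q. \<forall>t\<in>\<rat> \<inter> {s..}. \<omega> \<in> Z s \<longrightarrow> 0 \<le> M t \<omega>"
    unfolding AE_ball_countable[OF c(2)] using M_nonneg[OF s] by simp
  ultimately have "AE \<omega> in Q. \<omega> \<in> Z s \<longrightarrow> ((\<lambda>t. M t \<omega> / X t \<omega>) \<longlongrightarrow> F \<omega>) at_top"
    using X_filterlim_at_top[OF A s] AE_space
  proof eventually_elim
    case (elim \<omega>)
    show ?case
    proof
      assume Z: "\<omega> \<in> Z s"
      have \<omega>: "\<omega> \<in> space P" using elim by simp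
      show "((\<lambda>t. M t \<omega> / X t \<omega>) \<longlongrightarrow> F \<omega>) at_top"
      proof (rule ratio_tendsto_pointwise[OF \<omega> _ _ _ _ s])
        fix h assume "h \<in> \<rat>" "F \<omega> < h"
        moreover from this have "0 < h" using F_nonneg[OF \<omega>] by simp
        ultimately show "\<omega> \<notin> limsup_rat (\<lambda>t. {\<omega>\<in>space P. h * X t \<omega> < M t \<omega>})"
          using elim(1) Z by auto
      qed (use elim(2-4) Z in auto)
    qed
  qed
  then show "AE \<omega> in Q. \<omega> \<in> Z (real n) \<longrightarrow> ((\<lambda>t. M t \<omega> / X t \<omega>) \<longlongrightarrow> F \<omega>) at_top"
    by (simp add: s_def)
qed

end

theorem proposition3p2:
  fixes P Q :: "'a measure" and G :: "real \<Rightarrow> 'a measure"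
    and X N A :: "real \<Rightarrow> 'a \<Rightarrow> real"
  assumes "filtered_prob_space P G"
    and "property_NP P G"
    and "class_Sigma P G X N A"
    and "associated_measure P G X Q"
    and "AE \<omega> in P. filterlim (\<lambda>t. A t \<omega>) at_top at_top"
  shows "(AE \<omega> in Q. filterlim (\<lambda>t. X t \<omega>) at_top at_top) \<and>
    (\<forall>F M. integrable Q F \<longrightarrow> (\<forall>\<omega>\<in>space Q. 0 \<le> F \<omega>) \<longrightarrow> associated_martingale P G Q F M \<longrightarrow>
       (AE \<omega> in Q. ((\<lambda>t. M t \<omega> / X t \<omega>) \<longlongrightarrow> F \<omega>) at_top))"
proof -
  interpret class_Sigma_space P Q G X N A
    by unfold_locales (fact assms property_NP_generated[OF assms(1,2)])+
  show ?thesis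
  proof (intro conjI allI impI)
    show "AE \<omega> in Q. filterlim (\<lambda>t. X t \<omega>) at_top at_top"
      by (rule AE_Z, rule X_filterlim_at_top[OF assms(5)]) simp
    fix F M
    assume "integrable Q F" "\<forall>\<omega>\<in>space Q. 0 \<le> F \<omega>" "associated_martingale P G Q F M"
    then interpret class_Sigma_functional P Q G X N A F M
      by unfold_locales auto
    show "AE \<omega> in Q. ((\<lambda>t. M t \<omega> / X t \<omega>) \<longlongrightarrow> F \<omega>) at_top"
      by (rule ratio_tendsto[OF assms(5)])
  qed
qed

end
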